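(* Let $T\in 2\pi\mathbb{N}$, $T>0$, and let $\bar\tau=(\tau_1,\tau_2,\dots)$ be the constant sequence $\tau_n=T$ for all $n$. Then there is a constant $c>0$ such that, for $\alpha>0$, $$\operatorname{mix}(b^{\bar\tau}_\alpha)\ \ge\ c\,\alpha^{-1}\ \ge\ c\,\|D_x b^{\bar\tau}_\alpha\|_{L^1}^{-1}.$$ In particular, even if $T>0$ is arbitrarily large, it is possible that $b^{\bar\tau}$ mixes at a subexponential rate when $\tau_n=T$ for all $n\in\mathbb{N}$.
   Context: Points of the torus $\mathbb{R}^2/(2\pi\mathbb{Z})^2$ are written $x=(x_1,x_2)$ with $x_1,x_2\in[0,2\pi)$. Define $b_{\mathrm{horiz}}(x):=(\sin x_2,0)$ and $b_{\mathrm{vert}}(x):=(0,\sin x_1)$. For a sequence $\bar\tau=(\tau_1,\tau_2,\dots)$ of nonnegative numbers define $$b^{\bar\tau}(t,x):=\begin{cases}\tau_{\lceil t\rceil}\,b_{\mathrm{horiz}}(x) & \text{if }\lceil t\rceil\text{ is odd},\\ \tau_{\lceil t\rceil}\,b_{\mathrm{vert}}(x) & \text{if }\lceil t\rceil\text{ is even},\end{cases}$$ and for $\alpha>0$ put $b^{\bar\tau}_\alpha(t,x):=\alpha\, b^{\bar\tau}(\alpha t,x)$. The norm $\|D_x b^{\bar\tau}_\alpha\|_{L^1}$ is the $L^1$ norm over $[0,1]\times\mathbb{R}^2/(2\pi\mathbb{Z})^2$. For a divergence-free field $b\in L^1([0,1];W^{1,1}(\mathbb{R}^2/(2\pi\mathbb{Z})^2;\mathbb{R}^2))$,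 the mixing scale is $$\operatorname{mix}(b):=\sup\left\{\operatorname{radius}(B)\ \middle|\ \left|\frac1{|B|}\int_B u(1,x)\,dx\right|>1\right\},$$ the supremum being over all balls $B\subseteq\mathbb{R}^2/(2\pi\mathbb{Z})^2$, where $|B|$ is the Lebesgue measure of $B$ and $u$ solves $D_tu+b\cdot D_xu=0$ with initial data $u(0,\cdot)=2\cdot\mathbf{1}_{\{x_1\le\pi\}}-2\cdot\mathbf{1}_{\{x_1>\pi\}}$.
   Formalization: The bound mix ≥ c/α cannot hold for all α>0 with one c, as mix ≤ √2π while c/α → ∞ when α → 0; it is proved for α ≥ 1, and for 0<α<1 replaced by mix ≥ c, the second inequality being kept for all α>0. *)

theory Defs
  imports "HOL-Analysis.Analysis" "HOL-Library.Landau_Symbols"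
begin

section \<open>The torus\<close>

text \<open>The torus \<open>\<real>\<^sup>2 / (2\<pi>\<int>)\<^sup>2\<close> is represented by the fundamental domain \<open>[0,2\<pi>)\<^sup>2\<close> with
  Lebesgue measure; smooth data on it are \<open>2\<pi>\<close>-periodic maps on the plane.\<close>

definition torus :: "(real \<times> real) set" where
  "torus = {0..<2*pi} \<times> {0..<2*pi}"

text \<open>Balls are taken for the quotient metric, so they wrap around the fundamental domain.\<close>

definition torus_ball :: "real \<times> real \<Rightarrow> real \<Rightarrow> (real \<times> real) set" where
  "torus_ball c r =
     {y \<in> torus. \<exists>m n :: int. dist c (y + (2*pi * of_int m, 2*pi * of_int n)) < r}"

definition space_periodic :: "(real \<times> (real \<times> real) \<Rightarrow> real) \<Rightarrow> bool" where
  "space_periodic \<phi> \<longleftrightarrow>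
     (\<forall>t x1 x2. \<phi> (t, (x1 + 2*pi, x2)) = \<phi> (t, (x1, x2)) \<and>
                \<phi> (t, (x1, x2 + 2*pi)) = \<phi> (t, (x1, x2)))"

section \<open>Alternating shear fields\<close>

definition b_horiz :: "real \<times> real \<Rightarrow> real \<times> real" where
  "b_horiz x = (sin (snd x), 0)"

definition b_vert :: "real \<times> real \<Rightarrow> real \<times> real" where
  "b_vert x = (0, sin (fst x))"

text \<open>The sequence is indexed from 1; \<open>\<tau> 0\<close> only enters at times \<open>t \<le> 0\<close>.\<close>

definition shear_field :: "(nat \<Rightarrow> real) \<Rightarrow> real \<Rightarrow> real \<times> real \<Rightarrow> real \<times> real" where
  "shear_field \<tau> t x =
     (if odd \<lceil>t\<rceil> then \<tau> (nat \<lceil>t\<rceil>) *\<^sub>R b_horiz x else \<tau> (nat \<lceil>t\<rceil>) *\<^sub>R b_vert x)"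

definition speed_up ::
  "real \<Rightarrow> (real \<Rightarrow> real \<times> real \<Rightarrow> real \<times> real) \<Rightarrow> real \<Rightarrow> real \<times> real \<Rightarrow> real \<times> real" where
  "speed_up \<alpha> b t x = \<alpha> *\<^sub>R b (\<alpha> * t) x"

text \<open>The fields considered here are smooth in \<open>x\<close> at each time, so the classical spatial derivative is the weak one;
  the matrix norm is the operator norm.\<close>

definition grad_L1_norm :: "(real \<Rightarrow> real \<times> real \<Rightarrow> real \<times> real) \<Rightarrow> real" where
  "grad_L1_norm b =
     (LINT p:{0..1} \<times> torus|lborel. onorm (frechet_derivative (b (fst p)) (at (snd p))))"

section \<open>Transport equation and mixing scale\<close>

definition initial_data :: "real \<times> real \<Rightarrow> real" where
  "initial_data x = 2 * indicator {x. fst x \<le> pi} x - 2 * indicator {x. fst x > pi} x"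

text \<open>Bounded weak solutions on \<open>[0,1]\<close> of \<open>D\<^sub>t u + b \<bullet> D\<^sub>x u = 0\<close> for divergence-free \<open>b\<close>, in the weakly
  continuous representative, so that the values at each time are meaningful up to null sets.
  With \<open>g\<close> the space-time gradient of the test function \<open>\<phi>\<close>, the integrand
  \<open>g p \<bullet> (1, b t x)\<close> is \<open>D\<^sub>t \<phi> + b \<bullet> D\<^sub>x \<phi>\<close>.\<close>

definition transport_solution ::
  "(real \<Rightarrow> real \<times> real \<Rightarrow> real \<times> real) \<Rightarrow> (real \<times> real \<Rightarrow> real) \<Rightarrow>
   (real \<Rightarrow> real \<times> real \<Rightarrow> real) \<Rightarrow> bool" where
  "transport_solution b u0 u \<longleftrightarrow>
     (\<lambda>p. u (fst p) (snd p)) \<in> borel_measurable borel \<and>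
     (\<exists>M. \<forall>t x. \<bar>u t x\<bar> \<le> M) \<and>
     (\<forall>\<phi> g. (\<forall>p. GDERIV \<phi> p :> g p) \<and> continuous_on UNIV g \<and> space_periodic \<phi> \<longrightarrow>
       (\<forall>t\<in>{0..1}.
         (LINT x:torus|lborel. u t x * \<phi> (t, x)) =
         (LINT x:torus|lborel. u0 x * \<phi> (0, x)) +
         (LINT p:{0..t} \<times> torus|lborel.
            u (fst p) (snd p) * (g p \<bullet> (1, b (fst p) (snd p))))))"

text \<open>The solution is unique up to null sets for the admissible fields (DiPerna--Lions), and ball averages do not
  depend on the representative. The set of radii below is then nonempty (Lebesgue differentiation)
  and bounded: a ball of radius larger than \<open>sqrt 2 * pi\<close> is the whole torus, on which \<open>u\<close> has mean 0.\<close>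

definition the_solution ::
  "(real \<Rightarrow> real \<times> real \<Rightarrow> real \<times> real) \<Rightarrow> real \<Rightarrow> real \<times> real \<Rightarrow> real" where
  "the_solution b = (SOME u. transport_solution b initial_data u)"

definition mix :: "(real \<Rightarrow> real \<times> real \<Rightarrow> real \<times> real) \<Rightarrow> real" where
  "mix b = Sup {r. r > 0 \<and> (\<exists>c\<in>torus.
     \<bar>1 / measure lborel (torus_ball c r) *
       (LINT x:torus_ball c r|lborel. the_solution b 1 x)\<bar> > 1)}"

text \<open>As \<open>\<alpha> \<rightarrow> \<infinity>\<close>, the mixing scale eventually dominates every exponential in the \<open>L\<^sup>1\<close> norm of the gradient.\<close>

definition mixes_subexponentially :: "(real \<Rightarrow> real \<times> real \<Rightarrow> real \<times> real) \<Rightarrow> bool" where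
  "mixes_subexponentially b \<longleftrightarrow>
     (\<forall>\<kappa>>0. (\<lambda>\<alpha>. exp (- \<kappa> * grad_L1_norm (speed_up \<alpha> b))) \<in> o[at_top](\<lambda>\<alpha>. mix (speed_up \<alpha> b)))"

end

theory Submission
  imports Defs
begin

text \<open>
  In each unit of unscaled time the flow is a shear by \<open>T\<close>, and \<open>T\<close> is a multiple of the period. At the point
  \<open>(\<pi>/2, \<pi>/2)\<close> both sines equal 1, so either shear moves this point by a lattice vector: it is a
  common fixed point on the torus. Both sines are moreover critical there, so the differential of
  either shear is the identity, and a displacement of size \<open>r\<close> grows in one step only to
  \<open>r + T r\<^sup>2 / 2\<close> (\<open>shear_near_fixed_point\<close>). The radii \<open>1 / (T (n + 1))\<close> absorb this quadratic growth
  (\<open>plateau_radius_Suc\<close>), so after \<open>n\<close> steps the solution is still equal to its initial value 2 on a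
  neighbourhood of size proportional to \<open>1 / n\<close> (\<open>profile_plateau\<close>). At time 1 about \<open>\<alpha>\<close> steps have
  been made, which gives a ball of radius \<open>c / \<alpha>\<close> with average 2 (\<open>shear_solution_plateau\<close>). The
  gradient norm grows linearly in \<open>\<alpha>\<close>, because at every time the norm of the derivative is \<open>\<alpha> T\<close>
  times the absolute value of a cosine (\<open>grad_L1_norm_lower_bound\<close>); so \<open>1 / \<alpha>\<close> dominates the inverse of this norm, as
  well as every negative exponential of it.

  The mixing scale speaks of an arbitrarily chosen weak solution, so two more facts are needed.
  Existence: the initial datum composed with the inverse flow solves the weak equation
  (\<open>shear_solution_is_solution\<close>); on the time interval of one shear this is the fundamental
  theorem of calculus along trajectories, Fubini, and invariance of Lebesgue measure under the shear.
  Uniqueness up to null sets: a test function transported backwards along one shear has vanishing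
  material derivative, so the pairing of a solution with test functions at the end of the interval is
  determined by its pairings at the start. The backward transport through all shears would not be
  differentiable at the switching times, which is why the argument runs interval by interval
  (\<open>solutions_agree_weakly\<close>). Pairings with test functions then determine ball averages
  (\<open>test_functions_determine_integrals\<close>).
\<close>

section \<open>Periodic functions and shears of the torus\<close>

definition periodic2 :: "(real \<times> real \<Rightarrow> 'a) \<Rightarrow> bool" where
  "periodic2 f \<longleftrightarrow>
     (\<forall>x y. f (x + 2 * pi, y) = f (x, y) \<and> f (x, y + 2 * pi) = f (x, y))"

lemma periodic1_int:
  fixes f :: "real \<Rightarrow> 'a"
  assumes "\<And>x. f (x + 2 * pi) = f x"
  shows "f (x + 2 * pi * of_int m) = f x"
proof -
  have nat: "f (y + 2 * pi * real n) = f y" for y n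
  proof (induction n)
    case (Suc n)
    have "f (y + 2 * pi * real (Suc n)) = f ((y + 2 * pi * real n) + 2 * pi)"
      by (simp add: algebra_simps)
    then show ?case using assms Suc by simp
  qed simp
  show ?thesis
  proof (cases "m \<ge> 0")
    case True
    then show ?thesis using nat[of x "nat m"] by simp
  next
    case False
    then show ?thesis using nat[of "x + 2 * pi * of_int m" "nat (- m)"] by simp
  qed
qed

lemma periodic2_int:
  assumes "periodic2 f"
  shows "f (x + (2 * pi * of_int m, 2 * pi * of_int n)) = f x"
  using periodic1_int[of "\<lambda>s. f (s, snd x + 2 * pi * of_int n)" "fst x" m]
    periodic1_int[of "\<lambda>s. f (fst x, s)" "snd x" n] assms
  by (cases x) (simp add: periodic2_def)

lemma reduce_mod_2pi:
  obtains m :: int where "x + 2 * pi * of_int m \<in> {0..<2*pi}"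
proof
  let ?k = "\<lfloor>x / (2 * pi)\<rfloor>"
  have "of_int ?k \<le> x / (2 * pi)" "x / (2 * pi) < of_int ?k + 1"
    by linarith+
  then have "of_int ?k * (2 * pi) \<le> x" "x < (of_int ?k + 1) * (2 * pi)"
    by (simp_all only: pos_le_divide_eq pos_divide_less_eq pi_gt_zero mult_pos_pos zero_less_numeral)
  then show "x + 2 * pi * of_int (- ?k) \<in> {0..<2*pi}"
    by (simp add: algebra_simps)
qed

lemma reduce_to_torus:
  obtains m n :: int where "x + (2 * pi * of_int m, 2 * pi * of_int n) \<in> torus"
proof -
  obtain m n :: int where "fst x + 2 * pi * of_int m \<in> {0..<2*pi}" "snd x + 2 * pi * of_int n \<in> {0..<2*pi}"
    using reduce_mod_2pi by metis
  then show ?thesis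
    by (intro that[of m n]) (cases x, simp add: torus_def)
qed

text \<open>The two directions share one definition, so that every lemma covers both; the flag is true for
  the horizontal shear. A shear field is constant along its own trajectories, which makes \<open>shear d a\<close>
  its flow for time \<open>a\<close>.\<close>

definition sfield :: "bool \<Rightarrow> real \<times> real \<Rightarrow> real \<times> real" where
  "sfield d x = (if d then b_horiz x else b_vert x)"

definition shear :: "bool \<Rightarrow> real \<Rightarrow> real \<times> real \<Rightarrow> real \<times> real" where
  "shear d a x = x + a *\<^sub>R sfield d x"

lemma sfield_shear [simp]: "sfield d (shear d a x) = sfield d x"
  by (cases x) (simp add: shear_def sfield_def b_horiz_def b_vert_def)

lemma shear_shear [simp]: "shear d a (shear d b x) = shear d (a + b) x"
  using sfield_shear[of d b x] by (simp add: shear_def algebra_simps)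

lemma shear_0 [simp]: "shear d 0 x = x"
  by (simp add: shear_def)

lemma shear_Pair:
  "shear d a (x, y) = (if d then (x + a * sin y, y) else (x, y + a * sin x))"
  by (simp add: shear_def sfield_def b_horiz_def b_vert_def)

lemma periodic2_sfield: "periodic2 (sfield d)"
  by (simp add: periodic2_def sfield_def b_horiz_def b_vert_def)

lemma periodic2_shear:
  assumes "periodic2 f" shows "periodic2 (\<lambda>x. f (shear d a x))"
  using assms
  by (auto simp: periodic2_def shear_Pair add.assoc add.commute[of "2 * pi"])
     (metis add.assoc add.commute)+

lemma continuous_sfield: "continuous_on UNIV (sfield d)"
  by (cases d) (auto simp: sfield_def[abs_def] b_horiz_def[abs_def] b_vert_def[abs_def]
      intro!: continuous_intros)

lemma measurable_sfield [measurable]: "sfield d \<in> borel_measurable borel"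
  by (intro borel_measurable_continuous_onI continuous_sfield)

lemma measurable_shear [measurable]: "(\<lambda>x. shear d a x) \<in> borel_measurable borel"
  unfolding shear_def by measurable

lemma sets_torus [measurable]: "torus \<in> sets borel"
  unfolding torus_def by (intro borel_Times) auto

lemma torus_subset_cbox: "torus \<subseteq> cbox (0, 0) (2*pi, 2*pi)"
  by (auto simp: torus_def)

lemma emeasure_torus_finite: "emeasure lborel torus < \<infinity>"
proof -
  have "emeasure lborel torus \<le> emeasure lborel (cbox (0, 0) (2*pi, 2*pi :: real))"
    by (intro emeasure_mono torus_subset_cbox) auto
  then show ?thesis by (simp add: emeasure_lborel_cbox_eq le_less_trans)
qed

text \<open>Everything integrated over the torus below is Borel and bounded.\<close>

lemma integrable_torus:
  fixes f :: "real \<times> real \<Rightarrow> real"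
  assumes "f \<in> borel_measurable borel" "\<And>x. x \<in> torus \<Longrightarrow> \<bar>f x\<bar> \<le> M"
  shows "set_integrable lborel torus f"
  unfolding set_integrable_def
  by (rule integrableI_bounded_set_indicator[where B=M])
     (use assms emeasure_torus_finite in auto)

text \<open>Only the translation modulo the period matters; after reducing it to \<open>[0, 2\<pi>)\<close>, the part of the
  shifted interval beyond \<open>2\<pi>\<close> is moved back by one period.\<close>

lemma integral_translate_circle:
  fixes f :: "real \<Rightarrow> real"
  assumes [measurable]: "f \<in> borel_measurable borel" and per: "\<And>x. f (x + 2 * pi) = f x"
    and bd: "\<And>x. \<bar>f x\<bar> \<le> M"
  shows "(LINT x:{0..<2*pi}|lborel. f (x + a)) = (LINT x:{0..<2*pi}|lborel. f x)"
proof -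
  obtain m where m: "a + 2 * pi * of_int m \<in> {0..<2*pi}" by (rule reduce_mod_2pi)
  define b where "b = a + 2 * pi * of_int m"
  have b: "0 \<le> b" "b < 2 * pi" using m by (auto simp: b_def)
  have [simp]: "emeasure lborel {l..<u} < top" for l u :: real
    by (cases "l \<le> u") auto
  have int: "set_integrable lborel {l..<u} f" for l u
    unfolding set_integrable_def
    by (rule integrableI_bounded_set_indicator[where B=M])
       (use bd in auto)
  have "(LINT x:{0..<2*pi}|lborel. f (x + a)) = (LINT x:{0..<2*pi}|lborel. f (b + 1 * x))"
    using periodic1_int[of f, OF per, of "_ + a" m]
    by (simp add: b_def algebra_simps)
  also have "\<dots> = (LINT x|lborel. indicator {b..<b+2*pi} (b + 1 * x) * f (b + 1 * x))"
    unfolding set_lebesgue_integral_def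
    by (rule Bochner_Integration.integral_cong) (auto split: split_indicator)
  also have "\<dots> = (LINT x:{b..<b+2*pi}|lborel. f x)"
    using lborel_integral_real_affine[of 1 "\<lambda>x. indicator {b..<b+2*pi} x * f x" b]
    by (simp add: set_lebesgue_integral_def)
  also have "{b..<b+2*pi} = {b..<2*pi} \<union> {2*pi..<b+2*pi}"
    using b by auto
  also have "(LINT x:\<dots>|lborel. f x) = (LINT x:{b..<2*pi}|lborel. f x) + (LINT x:{2*pi..<b+2*pi}|lborel. f x)"
    by (rule set_integral_Un) (auto intro: int)
  also have "(LINT x:{2*pi..<b+2*pi}|lborel. f x) = (LINT x|lborel. indicator {2*pi..<b+2*pi} (2 * pi + 1 * x) * f (2 * pi + 1 * x))"
    using lborel_integral_real_affine[of 1 "\<lambda>x. indicator {2*pi..<b+2*pi} x * f x" "2 * pi"]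
    by (simp add: set_lebesgue_integral_def)
  also have "\<dots> = (LINT x:{0..<b}|lborel. f x)"
    unfolding set_lebesgue_integral_def
    by (rule Bochner_Integration.integral_cong)
       (auto simp: per add.commute[of "2 * pi"] split: split_indicator)
  also have "(LINT x:{b..<2*pi}|lborel. f x) + (LINT x:{0..<b}|lborel. f x) = (LINT x:{b..<2*pi} \<union> {0..<b}|lborel. f x)"
    by (rule set_integral_Un[symmetric]) (auto intro: int)
  also have "{b..<2*pi} \<union> {0..<b} = {0..<2*pi}" using b by auto
  finally show ?thesis .
qed

lemma torus_integral_iterated:
  fixes f :: "real \<times> real \<Rightarrow> real"
  assumes "f \<in> borel_measurable borel" "\<And>x. \<bar>f x\<bar> \<le> M"
  shows "(LINT x:torus|lborel. f x) =
           (LINT y:{0..<2*pi}|lborel. LINT x:{0..<2*pi}|lborel. f (x, y))" (is "_ = ?A")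
    and "(LINT x:torus|lborel. f x) =
           (LINT x:{0..<2*pi}|lborel. LINT y:{0..<2*pi}|lborel. f (x, y))" (is "_ = ?B")
proof -
  let ?F = "\<lambda>x y. indicator torus (x, y) * f (x, y)"
  have i: "integrable (lborel \<Otimes>\<^sub>M lborel) (case_prod ?F)"
    using integrable_torus[of f M] assms
    unfolding lborel_prod by (simp add: set_integrable_def case_prod_beta')
  have ind: "indicator torus (x, y) = (indicator {0..<2*pi} x * indicator {0..<2*pi} y :: real)" for x y
    by (auto simp: torus_def split: split_indicator)
  have L: "(\<integral>p. case_prod ?F p \<partial>(lborel \<Otimes>\<^sub>M lborel)) = (LINT x:torus|lborel. f x)"
    by (simp add: lborel_prod set_lebesgue_integral_def case_prod_beta')
  show "(LINT x:torus|lborel. f x) = ?A"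
    unfolding L[symmetric] lborel_pair.integral_snd[OF i, symmetric]
    by (simp add: set_lebesgue_integral_def ind mult_ac flip: integral_mult_right_zero)
  show "(LINT x:torus|lborel. f x) = ?B"
    unfolding L[symmetric] lborel_pair.integral_fst[OF i, symmetric]
    by (simp add: set_lebesgue_integral_def ind mult_ac flip: integral_mult_right_zero)
qed

text \<open>A shear translates every line parallel to its direction, so its invariance follows from that of
  one-dimensional integrals by integrating first along the direction of the shear.\<close>

lemma torus_integral_shear:
  fixes f :: "real \<times> real \<Rightarrow> real"
  assumes [measurable]: "f \<in> borel_measurable borel" and per: "periodic2 f" and bd: "\<And>x. \<bar>f x\<bar> \<le> M"
  shows "(LINT x:torus|lborel. f (shear d a x)) = (LINT x:torus|lborel. f x)"
proof (cases d)
  case True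
  have "(LINT x:{0..<2*pi}|lborel. f (x + a * sin y, y)) = (LINT x:{0..<2*pi}|lborel. f (x, y))" for y
    by (rule integral_translate_circle[of "\<lambda>x. f (x, y)" M]) (use bd per in \<open>auto simp: periodic2_def\<close>)
  then show ?thesis
    using True bd by (simp add: torus_integral_iterated(1)[of _ M] shear_Pair)
next
  case False
  have "(LINT y:{0..<2*pi}|lborel. f (x, y + a * sin x)) = (LINT y:{0..<2*pi}|lborel. f (x, y))" for x
    by (rule integral_translate_circle[of "\<lambda>y. f (x, y)" M]) (use bd per in \<open>auto simp: periodic2_def\<close>)
  then show ?thesis
    using False bd by (simp add: torus_integral_iterated(2)[of _ M] shear_Pair)
qed

section \<open>The weak equation along one shear\<close>

lemma GDERIV_unique:
  assumes "GDERIV f x :> D" "GDERIV f x :> E" shows "D = E"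
proof -
  have "(\<lambda>h. h \<bullet> D) = (\<lambda>h. h \<bullet> E)"
    using assms unfolding gderiv_def by (rule has_derivative_unique)
  then have "(D - E) \<bullet> D = (D - E) \<bullet> E" by metis
  then have "(D - E) \<bullet> (D - E) = 0" by (simp add: inner_diff_right)
  then show ?thesis by simp
qed

lemma periodic2_gradient:
  assumes g: "\<And>p. GDERIV \<phi> p :> g p" and per: "space_periodic \<phi>"
  shows "periodic2 (\<lambda>x. g (t, x))"
proof -
  have shift: "g (p + e) = g p" if e: "\<And>q. \<phi> (q + e) = \<phi> q" for p e
  proof (rule GDERIV_unique)
    have "((\<lambda>q. \<phi> (q + e)) has_derivative (\<lambda>h. h \<bullet> g (p + e))) (at p)"
      using g[of "p + e", unfolded gderiv_def]
      by (intro has_derivative_compose[of "\<lambda>q. q + e" "\<lambda>h. h", where g=\<phi>]) (auto intro!: derivative_eq_intros)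
    then show "GDERIV \<phi> p :> g (p + e)" by (simp add: e gderiv_def)
  qed (rule g)
  show ?thesis
    using shift[of "(0, (2*pi, 0))"] shift[of "(0, (0, 2*pi))"] per
    by (simp add: periodic2_def space_periodic_def split_paired_all)
qed

lemma periodic2_continuous_bounded:
  fixes f :: "real \<times> real \<Rightarrow> real"
  assumes "periodic2 f" "continuous_on UNIV f"
  obtains M where "\<And>x. \<bar>f x\<bar> \<le> M"
proof -
  have "compact (f ` cbox (0, 0) (2*pi, 2*pi))"
    by (intro compact_continuous_image continuous_on_subset[OF assms(2)]) auto
  then obtain M where M: "\<And>x. x \<in> cbox (0, 0) (2*pi, 2*pi) \<Longrightarrow> \<bar>f x\<bar> \<le> M"
    using compact_imp_bounded bounded_iff[of "f ` cbox (0, 0) (2*pi, 2*pi)"] by auto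
  have "\<bar>f x\<bar> \<le> M" for x
  proof -
    obtain m n where "x + (2 * pi * of_int m, 2 * pi * of_int n) \<in> torus"
      by (rule reduce_to_torus)
    from M[OF subsetD[OF torus_subset_cbox this]] show ?thesis
      by (simp add: periodic2_int[OF assms(1)])
  qed
  then show ?thesis by (rule that)
qed

lemma integrable_slab:
  fixes k :: "real \<times> (real \<times> real) \<Rightarrow> real" and W :: "real \<times> (real \<times> real) \<Rightarrow> real"
  assumes [measurable]: "W \<in> borel_measurable borel" and "\<And>p. \<bar>W p\<bar> \<le> M" and k: "continuous_on UNIV k"
  shows "set_integrable lborel ({s..t} \<times> torus) (\<lambda>p. W p * k p)"
proof -
  let ?K = "cbox (s, (0, 0)) (t, (2*pi, 2*pi)) :: (real \<times> real \<times> real) set"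
  have [measurable]: "k \<in> borel_measurable borel" using k by (rule borel_measurable_continuous_onI)
  have "compact (k ` ?K)"
    by (intro compact_continuous_image continuous_on_subset[OF k]) auto
  then obtain N where N: "\<And>x. x \<in> ?K \<Longrightarrow> \<bar>k x\<bar> \<le> N"
    using compact_imp_bounded bounded_iff[of "k ` ?K"] by auto
  have "set_integrable lborel ?K (\<lambda>p. W p * k p)"
    unfolding set_integrable_def
  proof (rule integrableI_bounded_set_indicator[where B="M * N"])
    show "AE p in lborel. p \<in> ?K \<longrightarrow> norm (W p * k p) \<le> M * N"
      using N assms(2) by (auto simp: abs_mult intro!: mult_mono order_trans[OF abs_ge_zero assms(2)])
  qed (auto simp: emeasure_lborel_cbox_eq)
  then show ?thesis
    by (rule set_integrable_subset) (auto simp: torus_def intro!: borel_Times)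
qed

lemma slab_integral_iterated:
  fixes F :: "real \<times> (real \<times> real) \<Rightarrow> real"
  assumes "set_integrable lborel ({s..t} \<times> torus) F"
  shows "(LINT p:{s..t} \<times> torus|lborel. F p) = (LINT r:{s..t}|lborel. LINT x:torus|lborel. F (r, x))" (is ?A)
    and "(LINT p:{s..t} \<times> torus|lborel. F p) = (LINT x:torus|lborel. LINT r:{s..t}|lborel. F (r, x))" (is ?B)
proof -
  let ?F = "\<lambda>r x. indicator ({s..t} \<times> torus) (r, x) * F (r, x)"
  have i: "integrable (lborel \<Otimes>\<^sub>M lborel) (case_prod ?F)"
    using assms unfolding lborel_prod by (simp add: set_integrable_def case_prod_beta')
  have ind: "indicator ({s..t} \<times> torus) (r, x) = (indicator {s..t} r * indicator torus x :: real)" for r x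
    by (auto split: split_indicator)
  have L: "(\<integral>p. case_prod ?F p \<partial>(lborel \<Otimes>\<^sub>M lborel)) = (LINT p:{s..t} \<times> torus|lborel. F p)"
    by (simp add: lborel_prod set_lebesgue_integral_def case_prod_beta')
  show ?A
    unfolding L[symmetric] lborel_pair.integral_fst[OF i, symmetric]
    by (simp add: set_lebesgue_integral_def ind mult_ac flip: integral_mult_right_zero)
  show ?B
    unfolding L[symmetric] lborel_pair.integral_snd[OF i, symmetric]
    by (simp add: set_lebesgue_integral_def ind mult_ac flip: integral_mult_right_zero)
qed

lemma continuous_shear2 [continuous_intros]:
  assumes "continuous_on S a" "continuous_on S f"
  shows "continuous_on S (\<lambda>p. shear d (a p) (f p))"
  unfolding shear_def
  by (intro continuous_intros assms continuous_on_compose2[OF continuous_sfield]) auto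

text \<open>Along a trajectory \<open>r \<mapsto> shear d (\<mu> (r - s)) x\<close> the transported function is constant and the
  derivative of \<open>\<phi>\<close> is the material derivative, so the fundamental theorem of calculus gives the
  identity for each \<open>x\<close>. Integrating over \<open>x\<close> and changing variables by the shear at each time \<open>r\<close>
  turns it into the weak equation on \<open>[s, t]\<close>.\<close>

lemma transported_weak_step:
  fixes w :: "real \<times> real \<Rightarrow> real" and \<mu> :: real and d :: bool
  assumes wm [measurable]: "w \<in> borel_measurable borel" and wper: "periodic2 w" and wb: "\<And>x. \<bar>w x\<bar> \<le> M"
    and g: "\<And>p. GDERIV \<phi> p :> g p" and cg: "continuous_on UNIV g" and per: "space_periodic \<phi>"
    and st: "s \<le> t"
  defines "F \<equiv> \<lambda>p. w (shear d (- (\<mu> * (fst p - s))) (snd p)) * (g p \<bullet> (1, \<mu> *\<^sub>R sfield d (snd p)))"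
  shows "set_integrable lborel ({s..t} \<times> torus) F"
    and "(LINT x:torus|lborel. w (shear d (- (\<mu> * (t - s))) x) * \<phi> (t, x)) =
         (LINT x:torus|lborel. w x * \<phi> (s, x)) + (LINT p:{s..t} \<times> torus|lborel. F p)"
proof -
  have cphi: "continuous_on UNIV \<phi>"
    by (rule has_derivative_continuous_on) (use g in \<open>simp add: gderiv_def\<close>)
  have pphi: "periodic2 (\<lambda>x. \<phi> (r, x))" for r
    using per by (simp add: periodic2_def space_periodic_def)
  note csf = continuous_on_compose2[OF continuous_sfield]
  note cgc = continuous_on_compose2[OF cg]
  define k where "k p = g (fst p, shear d (\<mu> * (fst p - s)) (snd p)) \<bullet> (1, \<mu> *\<^sub>R sfield d (snd p))" for p
  have ck: "continuous_on UNIV k"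
    unfolding k_def by (intro continuous_intros cgc csf) auto
  have [measurable]: "\<phi> \<in> borel_measurable borel" "g \<in> borel_measurable borel"
    using cphi cg by (auto intro: borel_measurable_continuous_onI)
  have [measurable]: "(\<lambda>p. w (shear d (- (\<mu> * (fst p - s))) (snd p))) \<in> borel_measurable borel"
    by (intro measurable_compose[OF borel_measurable_continuous_onI wm] continuous_intros)
  have [measurable]: "(\<lambda>p. w (snd p)) \<in> borel_measurable (borel :: (real \<times> real \<times> real) measure)"
    by (intro measurable_compose[OF borel_measurable_continuous_onI wm] continuous_intros)
  show int: "set_integrable lborel ({s..t} \<times> torus) F"
    unfolding F_def
    by (rule integrable_slab[where M=M])
       (auto intro!: wb continuous_intros cgc csf)
  have intk: "set_integrable lborel ({s..t} \<times> torus) (\<lambda>p. w (snd p) * k p)"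
    by (rule integrable_slab[where M=M]) (auto intro!: wb ck)
  \<comment> \<open>change of variables at a fixed time: it makes the transported function independent of \<open>r\<close>\<close>
  have pull: "(LINT x:torus|lborel. F (r, x)) = (LINT x:torus|lborel. w x * k (r, x))" for r
  proof -
    let ?h = "\<lambda>x. g (r, x) \<bullet> (1, \<mu> *\<^sub>R sfield d x)"
    have ph: "periodic2 ?h"
      using periodic2_gradient[OF g per, of r] periodic2_sfield[of d] by (simp add: periodic2_def)
    obtain N where N: "\<And>x. \<bar>?h x\<bar> \<le> N"
      by (rule periodic2_continuous_bounded[OF ph]) (auto intro!: continuous_intros cgc csf)
    have pF: "periodic2 (\<lambda>x. F (r, x))"
      using ph periodic2_shear[OF wper, of d "- (\<mu> * (r - s))"] by (simp add: F_def periodic2_def)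
    have "\<bar>F (r, x)\<bar> \<le> M * N" for x
      unfolding F_def abs_mult fst_conv snd_conv
      by (intro mult_mono wb N order_trans[OF abs_ge_zero wb] abs_ge_zero)
    then have "(LINT x:torus|lborel. F (r, x)) = (LINT x:torus|lborel. F (r, shear d (\<mu> * (r - s)) x))"
      by (intro torus_integral_shear[symmetric] pF) (auto simp: F_def)
    then show ?thesis by (simp add: F_def k_def)
  qed
  have ftc: "(LINT r:{s..t}|lborel. w x * k (r, x)) = w x * (\<phi> (t, shear d (\<mu> * (t - s)) x) - \<phi> (s, x))" for x
  proof -
    have "((\<lambda>r. \<phi> (r, shear d (\<mu> * (r - s)) x)) has_vector_derivative k (r, x)) (at r)" for r
    proof -
      have 1: "((\<lambda>r. (r, shear d (\<mu> * (r - s)) x)) has_derivative (\<lambda>h. h *\<^sub>R (1, \<mu> *\<^sub>R sfield d x))) (at r)"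
        unfolding shear_def
        by (auto intro!: derivative_eq_intros simp: algebra_simps)
      have "((\<lambda>r. \<phi> (r, shear d (\<mu> * (r - s)) x)) has_derivative
          (\<lambda>h. (h *\<^sub>R (1, \<mu> *\<^sub>R sfield d x)) \<bullet> g (r, shear d (\<mu> * (r - s)) x))) (at r)"
        using has_derivative_compose[OF 1, of \<phi>] g[unfolded gderiv_def] by blast
      then show ?thesis
        by (simp only: has_vector_derivative_def k_def inner_commute[of "g _"] inner_scaleR_left fst_conv snd_conv real_scaleR_def)
    qed
    then have "(\<integral>r. indicator {s..t} r *\<^sub>R k (r, x) \<partial>lborel) =
        \<phi> (t, shear d (\<mu> * (t - s)) x) - \<phi> (s, shear d (\<mu> * (s - s)) x)"
      by (intro integral_FTC_atLeastAtMost st)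
         (auto intro!: continuous_on_compose2[OF ck] continuous_intros intro: has_vector_derivative_at_within)
    then show ?thesis
      by (simp add: set_lebesgue_integral_def mult.left_commute flip: integral_mult_right_zero)
  qed
  obtain N where N: "\<And>x. \<bar>\<phi> (t, x)\<bar> \<le> N"
    by (rule periodic2_continuous_bounded[OF pphi]) (auto intro!: continuous_on_compose2[OF cphi] continuous_intros)
  obtain N' where N': "\<And>x. \<bar>\<phi> (s, x)\<bar> \<le> N'"
    by (rule periodic2_continuous_bounded[OF pphi]) (auto intro!: continuous_on_compose2[OF cphi] continuous_intros)
  have bd: "\<bar>w x * \<phi> (t, y)\<bar> \<le> M * N" "\<bar>w x * \<phi> (s, y)\<bar> \<le> M * N'" for x y
    unfolding abs_mult by (intro mult_mono wb N N' order_trans[OF abs_ge_zero wb] abs_ge_zero)+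
  have "(LINT p:{s..t} \<times> torus|lborel. F p) = (LINT p:{s..t} \<times> torus|lborel. w (snd p) * k p)"
    by (simp add: slab_integral_iterated(1)[OF int] slab_integral_iterated(1)[OF intk] pull)
  also have "\<dots> = (LINT x:torus|lborel. w x * \<phi> (t, shear d (\<mu> * (t - s)) x) - w x * \<phi> (s, x))"
    unfolding slab_integral_iterated(2)[OF intk] fst_conv snd_conv ftc right_diff_distrib ..
  also have "\<dots> = (LINT x:torus|lborel. w x * \<phi> (t, shear d (\<mu> * (t - s)) x)) - (LINT x:torus|lborel. w x * \<phi> (s, x))"
    by (intro set_integral_diff integrable_torus[where M="M * N"] integrable_torus[where M="M * N'"])
       (auto intro: bd)
  also have "(LINT x:torus|lborel. w x * \<phi> (t, shear d (\<mu> * (t - s)) x)) =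
      (LINT x:torus|lborel. w (shear d (- (\<mu> * (t - s))) (shear d (\<mu> * (t - s)) x)) * \<phi> (t, shear d (\<mu> * (t - s)) x))"
    by simp
  also have "\<dots> = (LINT x:torus|lborel. w (shear d (- (\<mu> * (t - s))) x) * \<phi> (t, x))"
    by (rule torus_integral_shear[where M="M * N"])
       (use pphi periodic2_shear[OF wper] bd in \<open>auto simp: periodic2_def\<close>)
  finally show "(LINT x:torus|lborel. w (shear d (- (\<mu> * (t - s))) x) * \<phi> (t, x)) =
         (LINT x:torus|lborel. w x * \<phi> (s, x)) + (LINT p:{s..t} \<times> torus|lborel. F p)"
    by simp
qed

section \<open>Uniqueness of weak solutions\<close>

definition test_function :: "(real \<times> real \<Rightarrow> real) \<Rightarrow> bool" where
  "test_function \<psi> \<longleftrightarrow> periodic2 \<psi> \<and>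
     (\<exists>G. (\<forall>x. GDERIV \<psi> x :> G x) \<and> continuous_on UNIV G)"

lemma test_function_continuous: "test_function \<psi> \<Longrightarrow> continuous_on UNIV \<psi>"
  unfolding test_function_def gderiv_def
  by (elim conjE exE, rule has_derivative_continuous_on) blast

text \<open>Transporting \<open>\<psi>\<close> backwards from time \<open>t\<close> by a single shear flow yields a test function, defined
  for all times, that is annihilated by the transport operator of this shear.\<close>

lemma backward_transported_test:
  fixes \<mu> t :: real and d :: bool
  assumes "test_function \<psi>"
  defines "\<phi> \<equiv> \<lambda>p. \<psi> (shear d (\<mu> * (t - fst p)) (snd p))"
  shows "\<exists>g. (\<forall>p. GDERIV \<phi> p :> g p) \<and> continuous_on UNIV g \<and> space_periodic \<phi> \<and>
    (\<forall>p. g p \<bullet> (1, \<mu> *\<^sub>R sfield d (snd p)) = 0)"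
proof -
  obtain G where G: "\<And>x. GDERIV \<psi> x :> G x" "continuous_on UNIV G" and per: "periodic2 \<psi>"
    using assms(1) by (auto simp: test_function_def)
  note cG = continuous_on_compose2[OF G(2)]
  define Y where "Y p = shear d (\<mu> * (t - fst p)) (snd p)" for p
  define g where "g p =
    (let G1 = fst (G (Y p)); G2 = snd (G (Y p)) in
     if d then (- \<mu> * sin (snd (snd p)) * G1, (G1, G1 * \<mu> * (t - fst p) * cos (snd (snd p)) + G2))
     else (- \<mu> * sin (fst (snd p)) * G2, (G1 + G2 * \<mu> * (t - fst p) * cos (fst (snd p)), G2)))" for p
  have Y: "(Y has_derivative
     (\<lambda>h. if d then (fst (snd h) + (- \<mu> * fst h) * sin (snd (snd p)) + \<mu> * (t - fst p) * cos (snd (snd p)) * snd (snd h), snd (snd h))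
      else (fst (snd h), snd (snd h) + (- \<mu> * fst h) * sin (fst (snd p)) + \<mu> * (t - fst p) * cos (fst (snd p)) * fst (snd h)))) (at p)" for p
    by (cases d) (auto simp: Y_def[abs_def] shear_def sfield_def b_horiz_def b_vert_def plus_prod_def
        algebra_simps intro!: derivative_eq_intros ext)
  have "GDERIV \<phi> p :> g p" for p
    unfolding gderiv_def \<phi>_def Y_def[symmetric]
    by (rule has_derivative_eq_rhs[OF has_derivative_compose[OF Y G(1)[unfolded gderiv_def]]])
       (auto simp: g_def Let_def inner_prod_def algebra_simps fun_eq_iff)
  moreover have "continuous_on UNIV g"
    unfolding g_def Let_def Y_def
    by (cases d) (auto intro!: continuous_intros cG)
  moreover have "space_periodic \<phi>"
    using periodic2_shear[OF per, of d]
    by (simp add: space_periodic_def periodic2_def \<phi>_def)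
  moreover have "g p \<bullet> (1, \<mu> *\<^sub>R sfield d (snd p)) = 0" for p
    by (auto simp: g_def Let_def inner_prod_def sfield_def b_horiz_def b_vert_def)
  ultimately show ?thesis by blast
qed

lemma test_function_shear:
  assumes "test_function \<psi>" shows "test_function (\<lambda>x. \<psi> (shear d a x))"
proof -
  obtain g where g: "\<And>p. GDERIV (\<lambda>p. \<psi> (shear d (1 * (a - fst p)) (snd p))) p :> g p" "continuous_on UNIV g"
    using backward_transported_test[OF assms, of d 1 a] by blast
  have "GDERIV (\<lambda>x. \<psi> (shear d a x)) x :> snd (g (0, x))" for x
  proof -
    have "((\<lambda>x. (0, x)) has_derivative (\<lambda>h. (0::real, h))) (at x)"
      by (auto intro!: derivative_eq_intros)
    from has_derivative_compose[OF this g(1)[unfolded gderiv_def]] show ?thesis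
      by (simp add: gderiv_def inner_prod_def)
  qed
  moreover have "continuous_on UNIV (\<lambda>x. snd (g (0, x)))"
    by (intro continuous_intros continuous_on_compose2[OF g(2)]) auto
  moreover have "periodic2 (\<lambda>x. \<psi> (shear d a x))"
    using assms by (simp add: test_function_def periodic2_shear)
  ultimately show ?thesis unfolding test_function_def
    by (intro conjI exI[of _ "\<lambda>x. snd (g (0, x))"] allI)
qed

text \<open>With the backward transported test function, the integrand of the weak equation vanishes on
  \<open>(s, t]\<close>, so the equations at times \<open>s\<close> and \<open>t\<close> have the same right hand side.\<close>

lemma transport_solution_shear_step:
  assumes sol: "transport_solution b u0 u" and st: "0 \<le> s" "s \<le> t" "t \<le> 1"
    and b: "\<And>r x. s < r \<Longrightarrow> r \<le> t \<Longrightarrow> b r x = \<mu> *\<^sub>R sfield d x"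
    and psi: "test_function \<psi>"
  shows "(LINT x:torus|lborel. u t x * \<psi> x) = (LINT x:torus|lborel. u s x * \<psi> (shear d (\<mu> * (t - s)) x))"
proof -
  define \<phi> where "\<phi> = (\<lambda>p. \<psi> (shear d (\<mu> * (t - fst p)) (snd p)))"
  obtain g where g: "\<And>p. GDERIV \<phi> p :> g p" "continuous_on UNIV g" "space_periodic \<phi>"
    and orth: "\<And>p. g p \<bullet> (1, \<mu> *\<^sub>R sfield d (snd p)) = 0"
    unfolding \<phi>_def using backward_transported_test[OF psi, of d \<mu> t] by blast
  let ?F = "\<lambda>p. u (fst p) (snd p) * (g p \<bullet> (1, b (fst p) (snd p)))"
  have W: "(LINT x:torus|lborel. u r x * \<phi> (r, x)) =
      (LINT x:torus|lborel. u0 x * \<phi> (0, x)) + (LINT p:{0..r} \<times> torus|lborel. ?F p)" if "r \<in> {0..1}" for r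
    using sol g that unfolding transport_solution_def by blast
  have "indicator ({0..t} \<times> torus) p *\<^sub>R ?F p = indicator ({0..s} \<times> torus) p *\<^sub>R ?F p" for p
    using st b[of "fst p" "snd p"] orth[of p] by (cases p) (auto split: split_indicator)
  then have "(LINT p:{0..t} \<times> torus|lborel. ?F p) = (LINT p:{0..s} \<times> torus|lborel. ?F p)"
    unfolding set_lebesgue_integral_def by presburger
  then have "(LINT x:torus|lborel. u t x * \<phi> (t, x)) = (LINT x:torus|lborel. u s x * \<phi> (s, x))"
    using W[of s] W[of t] st by simp
  then show ?thesis by (simp add: \<phi>_def)
qed

lemma shear_field_piece:
  assumes "\<alpha> > 0" "real n / \<alpha> < r" "r \<le> real (Suc n) / \<alpha>"
  shows "speed_up \<alpha> (shear_field (\<lambda>_. T)) r x = (\<alpha> * T) *\<^sub>R sfield (even n) x"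
proof -
  have "\<lceil>\<alpha> * r\<rceil> = int (Suc n)"
    using assms by (intro ceiling_unique) (auto simp: field_simps)
  then show ?thesis by (simp add: speed_up_def shear_field_def sfield_def)
qed

text \<open>Induction over the intervals on which the field is a single shear; each step replaces \<open>\<psi>\<close> by
  its composition with that shear, hence the quantification over all test functions.\<close>

lemma solutions_agree_weakly:
  fixes \<alpha> T :: real
  defines "b \<equiv> speed_up \<alpha> (shear_field (\<lambda>_. T))"
  assumes \<alpha>: "\<alpha> > 0" and u: "transport_solution b u0 u" and v: "transport_solution b u0 v"
    and t: "0 \<le> t" "t \<le> 1" and psi: "test_function \<psi>"
  shows "(LINT x:torus|lborel. u t x * \<psi> x) = (LINT x:torus|lborel. v t x * \<psi> x)"
proof -
  have "(LINT x:torus|lborel. u t x * \<psi> x) = (LINT x:torus|lborel. v t x * \<psi> x)"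
    if "0 \<le> t" "t \<le> 1" "t \<le> real n / \<alpha>" "test_function \<psi>" for n t \<psi>
    using that
  proof (induction n arbitrary: t \<psi>)
    case 0
    \<comment> \<open>\<open>\<psi>\<close> is extended to space-time by transport along a field of strength 0\<close>
    have init: "(LINT x:torus|lborel. z 0 x * \<psi> x) = (LINT x:torus|lborel. u0 x * \<psi> x)"
      if z: "transport_solution b u0 z" for z
    proof -
      obtain g where g: "\<And>p. GDERIV (\<lambda>p. \<psi> (shear True (0 * (0 - fst p)) (snd p))) p :> g p" "continuous_on UNIV g"
          "space_periodic (\<lambda>p. \<psi> (shear True (0 * (0 - fst p)) (snd p)))"
        using backward_transported_test[OF 0(4), where d=True and \<mu>=0 and t=0] by blast
      have null: "emeasure lborel ({0::real} \<times> torus) = 0"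
        using lborel.emeasure_pair_measure_Times[of "{0::real}" lborel torus] by (simp add: lborel_prod)
      have "(LINT p:{0..0} \<times> torus|lborel. z (fst p) (snd p) * (g p \<bullet> (1, b (fst p) (snd p)))) = 0"
        unfolding set_lebesgue_integral_def
        by (intro integral_eq_zero_AE AE_I'[of "{0} \<times> torus"])
           (auto simp: null null_sets_def split: split_indicator intro!: borel_Times)
      moreover have "(LINT x:torus|lborel. z 0 x * \<psi> (shear True (0 * (0 - fst (0::real, x))) (snd (0::real, x)))) =
          (LINT x:torus|lborel. u0 x * \<psi> (shear True (0 * (0 - fst (0::real, x))) (snd (0::real, x)))) +
          (LINT p:{0..0} \<times> torus|lborel. z (fst p) (snd p) * (g p \<bullet> (1, b (fst p) (snd p))))"
        using z g unfolding transport_solution_def by (meson atLeastAtMost_iff order_refl zero_le_one)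
      ultimately show ?thesis by simp
    qed
    have "t = 0" using 0 by simp
    then show ?case using init[OF u] init[OF v] by simp
  next
    case (Suc n)
    show ?case
    proof (cases "t \<le> real n / \<alpha>")
      case True
      then show ?thesis using Suc by blast
    next
      case False
      define s where "s = real n / \<alpha>"
      have s: "0 \<le> s" "s \<le> t" using False \<alpha> by (auto simp: s_def)
      have b: "b r x = (\<alpha> * T) *\<^sub>R sfield (even n) x" if "s < r" "r \<le> t" for r x
        unfolding b_def by (rule shear_field_piece) (use that Suc.prems \<alpha> s_def in auto)
      have "(LINT x:torus|lborel. u s x * \<psi> (shear (even n) (\<alpha> * T * (t - s)) x)) =
            (LINT x:torus|lborel. v s x * \<psi> (shear (even n) (\<alpha> * T * (t - s)) x))"
        by (rule Suc.IH) (use s Suc.prems test_function_shear in \<open>auto simp flip: s_def\<close>)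
      then show ?thesis
        using transport_solution_shear_step[OF u s(1,2) _ b Suc.prems(4)]
          transport_solution_shear_step[OF v s(1,2) _ b Suc.prems(4)] Suc.prems by simp
    qed
  qed
  moreover obtain n where "\<alpha> * t \<le> real n" using real_arch_simple by blast
  then have "t \<le> real n / \<alpha>" using \<alpha> by (simp add: field_simps)
  ultimately show ?thesis using t psi by blast
qed

section \<open>Test functions determine integrals\<close>

lemma DERIV_positive_part_square:
  "((\<lambda>s::real. (max 0 s)\<^sup>2) has_real_derivative 2 * max 0 s) (at s)"
proof -
  consider "s > 0" | "s < 0" | "s = 0" by linarith
  then show ?thesis
  proof cases
    case 1
    have "((\<lambda>s::real. s\<^sup>2) has_real_derivative 2 * max 0 s) (at s)"
      using 1 by (auto intro!: derivative_eq_intros)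
    then show ?thesis
      by (rule has_field_derivative_transform_within_open[where S="{0<..}"]) (use 1 in auto)
  next
    case 2
    have "((\<lambda>s::real. 0) has_real_derivative 2 * max 0 s) (at s)"
      using 2 by (auto intro!: derivative_eq_intros)
    then show ?thesis
      by (rule has_field_derivative_transform_within_open[where S="{..<0}"]) (use 2 in auto)
  next
    case 3
    have "((\<lambda>h::real. (max 0 h)\<^sup>2 / h) \<longlongrightarrow> 0) (at 0)"
      by (rule Lim_null_comparison[of _ "\<lambda>h. \<bar>h\<bar>"])
         (auto intro!: tendsto_eq_intros simp: eventually_at_filter max_def power2_eq_square)
    then show ?thesis using 3 by (simp add: DERIV_def)
  qed
qed

text \<open>A periodic \<open>C\<^sup>1\<close> function that is positive exactly on the arc of half-width \<open>l\<close> around \<open>m\<close>;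
  squaring the positive part makes it differentiable at the end points.\<close>

definition hump :: "real \<Rightarrow> real \<Rightarrow> real \<Rightarrow> real" where
  "hump m l x = (max 0 (cos (x - m) - cos l))\<^sup>2"

definition hump' :: "real \<Rightarrow> real \<Rightarrow> real \<Rightarrow> real" where
  "hump' m l x = 2 * max 0 (cos (x - m) - cos l) * - sin (x - m)"

lemma DERIV_hump: "(hump m l has_real_derivative hump' m l x) (at x)"
proof -
  have "((\<lambda>x. cos (x - m) - cos l) has_real_derivative - sin (x - m)) (at x)"
    by (auto intro!: derivative_eq_intros)
  from DERIV_chain2[OF DERIV_positive_part_square this] show ?thesis
    by (simp add: hump_def[abs_def] hump'_def)
qed

lemma hump_bounds: "0 \<le> hump m l x" "hump m l x \<le> 4"
proof -
  have "\<bar>max 0 (cos (x - m) - cos l)\<bar> \<le> \<bar>2\<bar>"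
    using add_mono[OF cos_le_one[of "x - m"] minus_le_iff[THEN iffD1, OF cos_ge_minus_one[of l]]]
    by (auto simp: max_def)
  from power2_le_iff_abs_le[THEN iffD2, OF _ this] show "hump m l x \<le> 4"
    by (simp add: hump_def abs_le_square_iff)
qed (simp add: hump_def)

lemma hump_pos_iff:
  assumes ab: "0 \<le> a" "a < b" "b \<le> 2 * pi" and x: "0 \<le> x" "x < 2 * pi"
  shows "hump ((a + b) / 2) ((b - a) / 2) x > 0 \<longleftrightarrow> a < x \<and> x < b"
proof -
  define m l where "m = (a + b) / 2" and "l = (b - a) / 2"
  have l: "0 < l" "l \<le> pi" using ab by (auto simp: l_def)
  have "hump m l x > 0 \<longleftrightarrow> cos l < cos \<bar>x - m\<bar>"
    by (auto simp: hump_def max_def)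
  also have "\<dots> \<longleftrightarrow> \<bar>x - m\<bar> < l"
  proof (cases "\<bar>x - m\<bar> \<le> pi")
    case True
    then show ?thesis using l by (intro cos_mono_less_eq) auto
  next
    case False
    have "cos \<bar>x - m\<bar> = cos (2 * pi - \<bar>x - m\<bar>)" by (simp add: cos_diff)
    moreover have "l \<le> 2 * pi - \<bar>x - m\<bar>" "2 * pi - \<bar>x - m\<bar> \<le> pi"
      using False ab x by (auto simp: m_def l_def abs_if field_simps)
    then have "cos (2 * pi - \<bar>x - m\<bar>) \<le> cos l"
      using l by (intro cos_monotone_0_pi_le) auto
    ultimately show ?thesis using False l by auto
  qed
  also have "\<dots> \<longleftrightarrow> a < x \<and> x < b" by (auto simp: m_def l_def abs_if field_simps)
  finally show ?thesis unfolding m_def l_def .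
qed

text \<open>The product of two humps, scaled by 16 into \<open>[0, 1]\<close>, is positive exactly on a box modulo the
  lattice. The exponent \<open>n\<close> makes these functions converge to the indicator of that box.\<close>

lemma test_function_hump_power:
  "test_function (\<lambda>x. 1 - (1 - hump m l (fst x) * hump m' l' (snd x) / 16) ^ n)"
proof -
  let ?q = "\<lambda>x. hump m l (fst x) * hump m' l' (snd x) / 16"
  let ?G = "\<lambda>x. (real n * (1 - ?q x) ^ (n - 1) / 16) *\<^sub>R
      (hump' m l (fst x) * hump m' l' (snd x), hump m l (fst x) * hump' m' l' (snd x))"
  have H: "((\<lambda>x. hump m l (fst x)) has_derivative (\<lambda>h. fst h * hump' m l (fst x))) (at x)"
       "((\<lambda>x. hump m' l' (snd x)) has_derivative (\<lambda>h. snd h * hump' m' l' (snd x))) (at x)" for x :: "real \<times> real"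
    using has_derivative_compose[OF _ DERIV_hump[unfolded has_field_derivative_def], of fst fst x UNIV m l]
      has_derivative_compose[OF _ DERIV_hump[unfolded has_field_derivative_def], of snd snd x UNIV m' l']
      has_derivative_fst[OF has_derivative_ident, of "at x"] has_derivative_snd[OF has_derivative_ident, of "at x"]
    by (simp_all add: mult.commute)
  have "((\<lambda>x. 1 - (1 - ?q x) ^ n) has_derivative (\<lambda>h. h \<bullet> ?G x)) (at x)" for x
  proof -
    have alg: "0 - N * (0 - (a * (h2 * b') + h1 * a' * b) / 16) * P = N * P / 16 * (h1 * (a' * b) + h2 * (a * b'))"
      for N a b a' b' h1 h2 P :: real
      by (simp add: field_simps)
    have "((\<lambda>x. hump m l (fst x) * hump m' l' (snd x) * (1 / 16)) has_derivative
        (\<lambda>h. (hump m l (fst x) * (snd h * hump' m' l' (snd x)) + fst h * hump' m l (fst x) * hump m' l' (snd x)) * (1 / 16))) (at x)"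
      by (intro has_derivative_mult_left has_derivative_mult H)
    note D = has_derivative_diff[OF has_derivative_const[of 1]
        has_derivative_power[OF has_derivative_diff[OF has_derivative_const[of 1] this], of n]]
    show ?thesis
      by (rule has_derivative_eq_rhs[OF D[unfolded times_divide_eq_right mult_1_right]])
         (rule ext, simp only: inner_scaleR_right, simp only: inner_prod_def fst_conv snd_conv inner_real_def alg)
  qed
  moreover have "continuous_on UNIV ?G"
    unfolding hump_def hump'_def by (intro continuous_intros) simp_all
  moreover have "hump m l (x + 2 * pi) = hump m l x" for m l x
    using cos_periodic[of "x - m"] by (simp add: hump_def algebra_simps)
  then have "periodic2 (\<lambda>x. 1 - (1 - ?q x) ^ n)"
    by (simp add: periodic2_def)
  ultimately show ?thesis
    unfolding test_function_def gderiv_def by (intro conjI exI[of _ ?G] allI)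
qed

lemma mem_box_prod:
  fixes a b c d :: real
  shows "x \<in> box (a, b) (c, d) \<longleftrightarrow> a < fst x \<and> fst x < c \<and> b < snd x \<and> snd x < d"
  by (cases x) (auto simp: mem_box Basis_prod_def)

lemma AE_lborel_fst_neq: "AE x in (lborel :: (real \<times> 'a::euclidean_space) measure). fst x \<noteq> c"
proof (rule AE_I'[of "{c} \<times> UNIV"])
  show "{c} \<times> UNIV \<in> null_sets (lborel :: (real \<times> 'a) measure)"
    using lborel.emeasure_pair_measure_Times[of "{c}" lborel "UNIV :: 'a set"]
    by (auto simp: null_sets_def lborel_prod intro!: borel_Times)
qed auto

lemma AE_lborel_snd_neq: "AE x in (lborel :: (real \<times> real) measure). snd x \<noteq> c"
proof (rule AE_I'[of "UNIV \<times> {c}"])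
  show "UNIV \<times> {c} \<in> null_sets (lborel :: (real \<times> real) measure)"
    using lborel.emeasure_pair_measure_Times[of "UNIV :: real set" lborel "{c}"]
    by (auto simp: null_sets_def lborel_prod intro!: borel_Times)
qed auto

lemma test_function_const: "test_function (\<lambda>_. c)"
  unfolding test_function_def periodic2_def
  by (intro conjI exI[of _ "\<lambda>_. 0"] allI GDERIV_const continuous_on_const) auto

text \<open>Boxes are reached by dominated convergence from the powers of humps. They generate the Borel
  sets and are closed under intersection, and the sets \<open>A\<close> with vanishing integral form a Dynkin
  system.\<close>

lemma test_functions_determine_integrals:
  fixes w :: "real \<times> real \<Rightarrow> real"
  assumes wm [measurable]: "w \<in> borel_measurable borel" and wb: "\<And>x. \<bar>w x\<bar> \<le> M"
    and zero: "\<And>\<psi>. test_function \<psi> \<Longrightarrow> (LINT x:torus|lborel. w x * \<psi> x) = 0"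
    and A: "A \<in> sets borel"
  shows "(LINT x:torus \<inter> A|lborel. w x) = 0"
proof -
  have intw: "set_integrable lborel (torus \<inter> A) w" if "A \<in> sets borel" for A
    by (rule set_integrable_subset[OF integrable_torus[where M=M]]) (use wb that in auto)
  have M0: "0 \<le> M" using order_trans[OF abs_ge_zero wb] .
  have total: "(LINT x:torus|lborel. w x) = 0"
    using zero[OF test_function_const[of 1]] by simp
  have box: "(LINT x:torus \<inter> box p q|lborel. w x) = 0" for p q
  proof (cases p, cases q)
    fix p1 p2 q1 q2 assume p: "p = (p1, p2)" and q: "q = (q1, q2)"
    \<comment> \<open>clamping to the fundamental square changes the box only on the lines \<open>x\<^sub>1 = 0\<close> and \<open>x\<^sub>2 = 0\<close>\<close>
    define a1 a2 b1 b2 where "a1 = max p1 0" and "a2 = max p2 0" and "b1 = min q1 (2*pi)" and "b2 = min q2 (2*pi)"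
    have box_eq: "x \<in> box (a1, a2) (b1, b2) \<longleftrightarrow> x \<in> box p q" if "x \<in> torus" "fst x \<noteq> 0" "snd x \<noteq> 0" for x
      using that unfolding p q mem_box_prod a1_def a2_def b1_def b2_def
      by (cases x) (auto simp: torus_def)
    show ?thesis
    proof (cases "a1 < b1 \<and> a2 < b2")
      case False
      then have empty: "x \<notin> box (a1, a2) (b1, b2)" for x
        unfolding mem_box_prod by linarith
      have "AE x in lborel. indicator (torus \<inter> box p q) x *\<^sub>R w x = 0"
        using AE_lborel_fst_neq[of 0] AE_lborel_snd_neq[of 0]
        by eventually_elim (use box_eq empty in \<open>auto split: split_indicator\<close>)
      then show ?thesis unfolding set_lebesgue_integral_def by (rule integral_eq_zero_AE)
    next
      case True
      define Q where "Q x = hump ((a1 + b1) / 2) ((b1 - a1) / 2) (fst x) * hump ((a2 + b2) / 2) ((b2 - a2) / 2) (snd x) / 16" for x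
      have "hump m l y * hump m' l' z \<le> 4 * 4" for m l y m' l' z
        by (intro mult_mono hump_bounds) auto
      then have Q01: "0 \<le> Q x" "Q x \<le> 1" for x
        by (simp_all add: Q_def hump_bounds)
      have Qpos: "Q x > 0 \<longleftrightarrow> x \<in> box (a1, a2) (b1, b2)" if "x \<in> torus" for x
      proof -
        have "Q x > 0 \<longleftrightarrow> hump ((a1 + b1) / 2) ((b1 - a1) / 2) (fst x) > 0 \<and> hump ((a2 + b2) / 2) ((b2 - a2) / 2) (snd x) > 0"
          unfolding Q_def by (simp add: zero_less_mult_iff not_less hump_bounds(1) leD)
        also have "\<dots> \<longleftrightarrow> (a1 < fst x \<and> fst x < b1) \<and> (a2 < snd x \<and> snd x < b2)"
          using that True by (intro arg_cong2[where f="(\<and>)"] hump_pos_iff) (auto simp: torus_def a1_def a2_def b1_def b2_def)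
        also have "\<dots> \<longleftrightarrow> x \<in> box (a1, a2) (b1, b2)"
          by (simp add: mem_box_prod)
        finally show ?thesis .
      qed
      have [measurable]: "Q \<in> borel_measurable borel"
        unfolding Q_def hump_def by (intro borel_measurable_continuous_onI continuous_intros) simp
      have lim: "(\<lambda>n. 1 - (1 - Q x) ^ n) \<longlonglongrightarrow> indicator (box (a1, a2) (b1, b2)) x" if "x \<in> torus" for x
      proof (cases "Q x > 0")
        case True
        have "(\<lambda>n. 1 - (1 - Q x) ^ n) \<longlonglongrightarrow> 1 - 0"
          by (intro tendsto_intros LIMSEQ_power_zero) (use Q01[of x] True in auto)
        then show ?thesis using True Qpos[OF that] by simp
      next
        case False
        then have "Q x = 0" using Q01(1)[of x] by linarith
        then show ?thesis using False Qpos[OF that] by simp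
      qed
      have "(\<lambda>n. LINT x:torus|lborel. w x * (1 - (1 - Q x) ^ n)) \<longlonglongrightarrow>
            (LINT x:torus|lborel. w x * indicator (box (a1, a2) (b1, b2)) x)"
        unfolding set_lebesgue_integral_def
      proof (rule integral_dominated_convergence[where w="\<lambda>x. indicator torus x * M"])
        show "integrable lborel (\<lambda>x. indicator torus x * M)"
          using integrable_torus[of "\<lambda>_. M" M] M0 by (simp add: set_integrable_def)
        show "AE x in lborel. (\<lambda>n. indicator torus x *\<^sub>R (w x * (1 - (1 - Q x) ^ n)))
            \<longlonglongrightarrow> indicator torus x *\<^sub>R (w x * indicator (box (a1, a2) (b1, b2)) x)"
        proof (rule AE_I2)
          fix x
          show "(\<lambda>n. indicator torus x *\<^sub>R (w x * (1 - (1 - Q x) ^ n)))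
            \<longlonglongrightarrow> indicator torus x *\<^sub>R (w x * indicator (box (a1, a2) (b1, b2)) x)"
          proof (cases "x \<in> torus")
            case True
            then show ?thesis by (intro tendsto_intros lim)
          qed simp
        qed
        show "AE x in lborel. norm (indicator torus x *\<^sub>R (w x * (1 - (1 - Q x) ^ n))) \<le> indicator torus x * M" for n
        proof (rule AE_I2)
          fix x
          have "0 \<le> (1 - Q x) ^ n" "(1 - Q x) ^ n \<le> 1" using Q01[of x] by (auto intro: power_le_one)
          then have "\<bar>w x\<bar> * \<bar>1 - (1 - Q x) ^ n\<bar> \<le> M * 1"
            by (intro mult_mono wb M0) auto
          then show "norm (indicator torus x *\<^sub>R (w x * (1 - (1 - Q x) ^ n))) \<le> indicator torus x * M"
            by (cases "x \<in> torus") (simp_all add: abs_mult)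
        qed
      qed auto
      moreover have "(LINT x:torus|lborel. w x * (1 - (1 - Q x) ^ n)) = 0" for n
        unfolding Q_def by (rule zero[OF test_function_hump_power])
      ultimately have "(LINT x:torus|lborel. w x * indicator (box (a1, a2) (b1, b2)) x) = 0"
        by (simp only: LIMSEQ_const_iff)
      moreover have "(LINT x:torus|lborel. w x * indicator (box (a1, a2) (b1, b2)) x) = (LINT x:torus \<inter> box p q|lborel. w x)"
        unfolding set_lebesgue_integral_def
      proof (rule integral_cong_AE)
        show "AE x in lborel. indicator torus x *\<^sub>R (w x * indicator (box (a1, a2) (b1, b2)) x) = indicator (torus \<inter> box p q) x *\<^sub>R w x"
          using AE_lborel_fst_neq[of 0] AE_lborel_snd_neq[of 0]
          by eventually_elim (use box_eq in \<open>auto split: split_indicator\<close>)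
      qed auto
      ultimately show ?thesis by simp
    qed
  qed
  let ?boxes = "range (\<lambda>(a, b). box a b :: (real \<times> real) set)"
  have borel: "sets borel = sigma_sets UNIV ?boxes" by (simp add: borel_eq_box)
  have "Int_stable ?boxes" by (auto simp: Int_stable_def box_Int_box)
  moreover have "?boxes \<subseteq> Pow UNIV" by simp
  moreover have "A \<in> sigma_sets UNIV ?boxes" using A borel by simp
  ultimately show ?thesis
  proof (induction rule: sigma_sets_induct_disjoint)
    case (basic A)
    then show ?case using box by auto
  next
    case empty
    then show ?case by (simp add: set_lebesgue_integral_def)
  next
    case (compl A)
    then have "A \<in> sets borel" using borel by simp
    then have "(LINT x:(torus \<inter> A) \<union> (torus \<inter> (UNIV - A))|lborel. w x) =
        (LINT x:torus \<inter> A|lborel. w x) + (LINT x:torus \<inter> (UNIV - A)|lborel. w x)"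
      by (intro set_integral_Un intw) auto
    moreover have "(torus \<inter> A) \<union> (torus \<inter> (UNIV - A)) = torus" by auto
    ultimately show ?case using compl total by simp
  next
    case (union A)
    have m: "A i \<in> sets borel" for i
      unfolding borel by (rule subsetD[OF union(2) rangeI])
    have U: "torus \<inter> (\<Union>i. A i) = (\<Union>i. torus \<inter> A i)" by blast
    have "(LINT x:(\<Union>i. torus \<inter> A i)|lborel. w x) = (\<Sum>i. LINT x:torus \<inter> A i|lborel. w x)"
    proof (rule lebesgue_integral_countable_add)
      show "set_integrable lborel (\<Union>i. torus \<inter> A i) w"
        unfolding U[symmetric] using m by (intro intw) auto
      show "(torus \<inter> A i) \<inter> (torus \<inter> A j) = {}" if "i \<noteq> j" for i j
        using disjoint_family_onD[OF union(1) _ _ that] by blast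
    qed (use m in simp)
    then show ?case unfolding U using union(3) by simp
  qed
qed

section \<open>The solution transported by the shears\<close>

text \<open>The periodic extension of the initial datum, up to the null set where the sine vanishes.\<close>

definition start_profile :: "real \<times> real \<Rightarrow> real" where
  "start_profile x = (if sin (fst x) > 0 then 2 else - 2)"

text \<open>The solution after \<open>n\<close> complete shears, that is, at time \<open>n / \<alpha>\<close>. The first shear is horizontal,
  hence \<open>even n\<close> for the shear that follows \<open>n\<close> others.\<close>

fun profile :: "real \<Rightarrow> nat \<Rightarrow> real \<times> real \<Rightarrow> real" where
  "profile T 0 = start_profile"
| "profile T (Suc n) = (\<lambda>x. profile T n (shear (even n) (- T) x))"

text \<open>The field is left-continuous in time, so the index counts the shears completed strictly before
  time \<open>t\<close>; truncated subtraction makes it 0 for \<open>t \<le> 0\<close>.\<close>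

definition shear_solution :: "real \<Rightarrow> real \<Rightarrow> real \<Rightarrow> real \<times> real \<Rightarrow> real" where
  "shear_solution \<alpha> T t x =
     (let n = nat \<lceil>\<alpha> * t\<rceil> - 1 in profile T n (shear (even n) (- (T * (\<alpha> * t - real n))) x))"

lemma profile_measurable [measurable]: "profile T n \<in> borel_measurable borel"
proof (induction n)
  case 0
  have "(\<lambda>x::real \<times> real. sin (fst x)) \<in> borel_measurable borel"
    by (intro borel_measurable_continuous_onI continuous_intros)
  then have [measurable]: "{x::real \<times> real. sin (fst x) > 0} \<in> sets borel"
    by measurable
  show ?case
    unfolding profile.simps start_profile_def[abs_def] by (rule measurable_If) simp_all
next
  case (Suc n)
  then show ?case using measurable_compose[OF measurable_shear Suc] by simp
qed

lemma profile_bounded: "\<bar>profile T n x\<bar> \<le> 2"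
  by (induction n arbitrary: x) (simp_all add: start_profile_def)

lemma profile_periodic: "periodic2 (profile T n)"
proof (induction n)
  case 0
  show ?case by (simp add: periodic2_def start_profile_def)
next
  case (Suc n)
  then show ?case using periodic2_shear by simp
qed

text \<open>At the left end point the formula refers to the previous index; it agrees there because a
  completed shear is the step of \<open>profile\<close>.\<close>

lemma shear_solution_piece:
  assumes \<alpha>: "\<alpha> > 0" and t: "real n / \<alpha> \<le> t" "t \<le> real (Suc n) / \<alpha>"
  shows "shear_solution \<alpha> T t x = profile T n (shear (even n) (- (\<alpha> * T * (t - real n / \<alpha>))) x)"
proof -
  have e: "\<alpha> * T * (t - real n / \<alpha>) = T * (\<alpha> * t - real n)"
    using \<alpha> by (simp add: field_simps)
  show ?thesis
  proof (cases "real n / \<alpha> < t")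
    case True
    have "\<lceil>\<alpha> * t\<rceil> = int (Suc n)"
      using \<alpha> t True by (intro ceiling_unique) (auto simp: field_simps)
    then have "nat \<lceil>\<alpha> * t\<rceil> = Suc n" by linarith
    then show ?thesis by (simp add: shear_solution_def e)
  next
    case False
    then have at: "\<alpha> * t = real n" using \<alpha> t by (simp add: field_simps)
    have idx: "nat \<lceil>\<alpha> * t\<rceil> = n" using at by simp
    show ?thesis
    proof (cases n)
      case 0
      then show ?thesis unfolding e shear_solution_def Let_def idx unfolding at by simp
    next
      case (Suc m)
      then show ?thesis unfolding e shear_solution_def Let_def idx unfolding at by simp
    qed
  qed
qed

text \<open>Joint measurability in time and space is proved for each value of the countable index
  \<open>\<lceil>\<alpha> t\<rceil>\<close>, where the dependence on time is continuous.\<close>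

lemma measurable_joint_shear:
  assumes [measurable]: "f \<in> borel_measurable borel" and "continuous_on UNIV a"
  shows "(\<lambda>p. f (shear d (a p) (snd p))) \<in> borel_measurable (borel :: (real \<times> real \<times> real) measure)"
  by (intro measurable_compose[OF borel_measurable_continuous_onI assms(1)] continuous_intros assms(2))

lemma measurable_index:
  "(\<lambda>p. \<lceil>\<alpha> * fst p\<rceil>) \<in> measurable (borel :: (real \<times> real \<times> real) measure) (count_space UNIV)"
  by (rule measurable_compose[OF _ measurable_real_ceiling])
     (intro borel_measurable_continuous_onI continuous_intros)

lemma shear_solution_measurable:
  "(\<lambda>p. shear_solution \<alpha> T (fst p) (snd p)) \<in> borel_measurable borel"
proof -
  have "(\<lambda>p. profile T (nat i - 1) (shear (even (nat i - 1)) (- (T * (\<alpha> * fst p - real (nat i - 1)))) (snd p)))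
     \<in> borel_measurable (borel :: (real \<times> real \<times> real) measure)" for i
    by (rule measurable_joint_shear[OF profile_measurable]) (auto intro!: continuous_intros)
  from measurable_compose_countable[OF this measurable_index[of \<alpha>]]
  show ?thesis unfolding shear_solution_def Let_def .
qed

lemma speed_up_shear_field:
  "speed_up \<alpha> (shear_field (\<lambda>_. T)) t x = (\<alpha> * T) *\<^sub>R sfield (odd \<lceil>\<alpha> * t\<rceil>) x"
  by (simp add: speed_up_def shear_field_def sfield_def)

lemma measurable_initial_data [measurable]: "initial_data \<in> borel_measurable borel"
proof -
  have [measurable]: "{x::real \<times> real. fst x \<le> pi} \<in> sets borel"
    by (intro borel_closed closed_Collect_le continuous_intros)
  have [measurable]: "{x::real \<times> real. fst x > pi} \<in> sets borel"
    by (intro borel_open open_Collect_less continuous_intros)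
  show ?thesis unfolding initial_data_def[abs_def] by measurable
qed

text \<open>The weak equations of the single shears add up. Field and solution are replaced by those of the
  current shear on the closed interval \<open>[s, t]\<close>, although the field at \<open>s\<close> itself still belongs to
  the previous shear: a single time is a null set. Integrability is carried through the induction so
  that the integrals over adjacent intervals can be added.\<close>

lemma shear_solution_is_solution:
  fixes \<alpha> T :: real
  defines "b \<equiv> speed_up \<alpha> (shear_field (\<lambda>_. T))"
  assumes \<alpha>: "\<alpha> > 0"
  shows "transport_solution b initial_data (shear_solution \<alpha> T)"
proof -
  let ?u = "shear_solution \<alpha> T"
  have weak: "(LINT x:torus|lborel. ?u t x * \<phi> (t, x)) =
         (LINT x:torus|lborel. initial_data x * \<phi> (0, x)) +
         (LINT p:{0..t} \<times> torus|lborel. ?u (fst p) (snd p) * (g p \<bullet> (1, b (fst p) (snd p))))"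
    if g: "\<And>p. GDERIV \<phi> p :> g p" and cg: "continuous_on UNIV g" and per: "space_periodic \<phi>" and t: "0 \<le> t" for \<phi> g t
  proof -
    define F where "F p = ?u (fst p) (snd p) * (g p \<bullet> (1, b (fst p) (snd p)))" for p
    have "(\<lambda>p. (\<alpha> * T) *\<^sub>R sfield (odd i) (snd p)) \<in> borel_measurable (borel :: (real \<times> real \<times> real) measure)" for i :: int
      by (intro borel_measurable_continuous_onI continuous_intros continuous_on_compose2[OF continuous_sfield]) auto
    from measurable_compose_countable[OF this measurable_index[of \<alpha>]]
    have mb: "(\<lambda>p. b (fst p) (snd p)) \<in> borel_measurable (borel :: (real \<times> real \<times> real) measure)"
      by (simp add: b_def speed_up_shear_field)
    have [measurable]: "(\<lambda>p. g p \<bullet> (1, b (fst p) (snd p))) \<in> borel_measurable borel"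
      by (intro borel_measurable_inner borel_measurable_continuous_onI[OF cg] borel_measurable_Pair mb) auto
    have Fm [measurable]: "F \<in> borel_measurable borel"
      unfolding F_def using shear_solution_measurable[of \<alpha> T] by measurable
    have [measurable]: "{s..t} \<times> torus \<in> sets borel" for s t :: real
      by (intro borel_Times) auto
    have FI: "(\<lambda>p. indicator ({s..t} \<times> torus) p *\<^sub>R F p) \<in> borel_measurable lborel" for s t :: real
      by measurable
    have pieces: "set_integrable lborel ({0..t} \<times> torus) F \<and>
       (LINT x:torus|lborel. ?u t x * \<phi> (t, x)) =
         (LINT x:torus|lborel. initial_data x * \<phi> (0, x)) + (LINT p:{0..t} \<times> torus|lborel. F p)"
      if "0 \<le> t" "t \<le> real n / \<alpha>" for n t
      using that
    proof (induction n arbitrary: t)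
      case 0
      then have t: "t = 0" by simp
      have ae: "AE p in lborel. indicator ({0..0} \<times> torus) p *\<^sub>R F p = 0"
        using AE_lborel_fst_neq[of 0] by eventually_elim (auto split: split_indicator)
      have "set_integrable lborel ({0..0} \<times> torus) F"
        unfolding set_integrable_def
        by (rule integrable_cong_AE[OF FI _ ae, THEN iffD2]) simp_all
      moreover have "(LINT p:{0..0} \<times> torus|lborel. F p) = 0"
        unfolding set_lebesgue_integral_def by (rule integral_eq_zero_AE[OF ae])
      moreover have "(LINT x:torus|lborel. ?u 0 x * \<phi> (0, x)) = (LINT x:torus|lborel. initial_data x * \<phi> (0, x))"
      proof -
        have "continuous_on UNIV (\<lambda>x. \<phi> (0, x))"
        proof (rule continuous_on_compose2[of UNIV \<phi>])
          show "continuous_on UNIV \<phi>"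
            by (rule has_derivative_continuous_on) (use g in \<open>simp add: gderiv_def\<close>)
        qed (auto intro!: continuous_intros)
        then have [measurable]: "(\<lambda>x. \<phi> (0, x)) \<in> borel_measurable borel"
          by (rule borel_measurable_continuous_onI)
        have u0: "?u 0 = profile T 0"
          using shear_solution_piece[OF \<alpha>, of 0 0 T] \<alpha> by auto
        show ?thesis unfolding set_lebesgue_integral_def
        proof (rule integral_cong_AE)
          show "AE x in lborel. indicator torus x *\<^sub>R (?u 0 x * \<phi> (0, x)) = indicator torus x *\<^sub>R (initial_data x * \<phi> (0, x))"
            using AE_lborel_fst_neq[of 0] AE_lborel_fst_neq[of pi]
          proof eventually_elim
            case (elim x)
            show ?case
            proof (cases "x \<in> torus")
              case True
              then have "0 < fst x" "fst x < 2 * pi" using elim by (auto simp: torus_def)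
              then have "profile T 0 x = initial_data x"
                using elim sin_gt_zero[of "fst x"] sin_lt_zero[of "fst x"]
                by (cases "fst x < pi") (auto simp: start_profile_def initial_data_def)
              then show ?thesis by (simp add: u0)
            qed simp
          qed
          show "(\<lambda>x. indicator torus x *\<^sub>R (?u 0 x * \<phi> (0, x))) \<in> borel_measurable lborel"
            unfolding u0 by measurable
          show "(\<lambda>x. indicator torus x *\<^sub>R (initial_data x * \<phi> (0, x))) \<in> borel_measurable lborel"
            by measurable
        qed
      qed
      ultimately show ?case using t by simp
    next
      case (Suc n)
      show ?case
      proof (cases "t \<le> real n / \<alpha>")
        case True
        then show ?thesis using Suc by blast
      next
        case False
        define s where "s = real n / \<alpha>"
        define G where "G p = profile T n (shear (even n) (- (\<alpha> * T * (fst p - s))) (snd p)) *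
            (g p \<bullet> (1, (\<alpha> * T) *\<^sub>R sfield (even n) (snd p)))" for p
        have s: "0 \<le> s" "s \<le> t" using False \<alpha> by (auto simp: s_def)
        have IH: "set_integrable lborel ({0..s} \<times> torus) F"
            "(LINT x:torus|lborel. ?u s x * \<phi> (s, x)) =
             (LINT x:torus|lborel. initial_data x * \<phi> (0, x)) + (LINT p:{0..s} \<times> torus|lborel. F p)"
          using Suc.IH[of s] s by (auto simp: s_def)
        have u: "?u r x = profile T n (shear (even n) (- (\<alpha> * T * (r - s))) x)" if "s \<le> r" "r \<le> t" for r x
          unfolding s_def by (rule shear_solution_piece) (use that Suc.prems \<alpha> in \<open>auto simp: s_def\<close>)
        note step = transported_weak_step[OF profile_measurable[of T n] profile_periodic profile_bounded g cg per s(2),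
            of "even n" "\<alpha> * T", folded G_def]
        have FG: "F p = G p" if "s < fst p" "fst p \<le> t" for p
          using that u[of "fst p"] shear_field_piece[OF \<alpha>, of n "fst p" T "snd p"] Suc.prems
          by (simp add: F_def G_def b_def s_def)
        have ae: "AE p in lborel. indicator ({s..t} \<times> torus) p *\<^sub>R F p = indicator ({s..t} \<times> torus) p *\<^sub>R G p"
          using AE_lborel_fst_neq[of s] by eventually_elim (use FG in \<open>auto split: split_indicator\<close>)
        have Gi: "set_integrable lborel ({s..t} \<times> torus) G" using step(1) by (simp add: G_def[abs_def])
        then have Gm: "(\<lambda>p. indicator ({s..t} \<times> torus) p *\<^sub>R G p) \<in> borel_measurable lborel"
          unfolding set_integrable_def by simp
        have Fi: "set_integrable lborel ({s..t} \<times> torus) F"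
          using Gi unfolding set_integrable_def
          by (rule integrable_cong_AE[OF FI Gm ae, THEN iffD2])
        have FGI: "(LINT p:{s..t} \<times> torus|lborel. F p) = (LINT p:{s..t} \<times> torus|lborel. G p)"
          unfolding set_lebesgue_integral_def by (rule integral_cong_AE[OF FI Gm ae])
        have un: "{0..t} \<times> torus = {0..s} \<times> torus \<union> {s..t} \<times> torus" using s by auto
        have "AE p in lborel. \<not> (p \<in> {0..s} \<times> torus \<and> p \<in> {s..t} \<times> torus)"
          using AE_lborel_fst_neq[of s] by eventually_elim auto
        then have "(LINT p:{0..t} \<times> torus|lborel. F p) = (LINT p:{0..s} \<times> torus|lborel. F p) + (LINT p:{s..t} \<times> torus|lborel. F p)"
          unfolding un by (rule set_integral_Un_AE) (use IH Fi in auto)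
        moreover have "set_integrable lborel ({0..t} \<times> torus) F"
          unfolding un by (rule set_integrable_Un) (use IH Fi in auto)
        moreover have "(LINT x:torus|lborel. ?u t x * \<phi> (t, x)) =
             (LINT x:torus|lborel. ?u s x * \<phi> (s, x)) + (LINT p:{s..t} \<times> torus|lborel. G p)"
          using step(2) u[of t] u[of s] s by (simp add: G_def)
        ultimately show ?thesis using IH(2) FGI by simp
      qed
    qed
    obtain n where "\<alpha> * t \<le> real n" using real_arch_simple by blast
    then have "t \<le> real n / \<alpha>" using \<alpha> by (simp add: field_simps)
    from pieces[OF t this] show ?thesis unfolding F_def by (rule conjunct2)
  qed
  have "\<bar>?u t x\<bar> \<le> 2" for t x
    unfolding shear_solution_def Let_def by (rule profile_bounded)
  then have bounded: "\<exists>M. \<forall>t x. \<bar>?u t x\<bar> \<le> M" by blast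
  show ?thesis
    unfolding transport_solution_def
  proof (intro conjI allI impI ballI shear_solution_measurable bounded)
    fix \<phi> g t
    assume "(\<forall>p. GDERIV \<phi> p :> g p) \<and> continuous_on UNIV g \<and> space_periodic \<phi>" "t \<in> {0..1::real}"
    then show "(LINT x:torus|lborel. ?u t x * \<phi> (t, x)) =
         (LINT x:torus|lborel. initial_data x * \<phi> (0, x)) +
         (LINT p:{0..t} \<times> torus|lborel. ?u (fst p) (snd p) * (g p \<bullet> (1, b (fst p) (snd p))))"
      by (intro weak) auto
  qed
qed

section \<open>A fixed point where the differential is the identity\<close>

lemma period_multiple_ge_2:
  assumes "T > 0" "T = 2 * pi * real k" shows "2 \<le> T"
proof -
  have "k > 0" using assms by (cases k) auto
  then have "2 * pi * 1 \<le> T" unfolding assms(2) by (intro mult_left_mono) auto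
  then show ?thesis using pi_gt3 by linarith
qed

lemma one_minus_cos_le: "1 - cos (x::real) \<le> x\<^sup>2 / 2"
proof -
  have "\<bar>sin (x / 2)\<bar> \<le> \<bar>x / 2\<bar>" by (rule abs_sin_x_le_abs_x)
  then have "(sin (x / 2))\<^sup>2 \<le> (x / 2)\<^sup>2" by (simp only: abs_le_square_iff)
  moreover have "cos x = 1 - 2 * (sin (x / 2))\<^sup>2" using cos_double_sin[of "x / 2"] by simp
  ultimately show ?thesis by (simp add: power_divide)
qed

text \<open>The inverse shear is compared at a displaced point and at the base point. With
  \<open>sin (\<pi>/2 + h) = cos h\<close>, the only error is \<open>\<theta> (1 - cos h)\<close>, which is quadratic in the
  displacement. Partial shears \<open>\<theta> \<le> T\<close> are included for the last, incomplete step.\<close>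

lemma shear_near_fixed_point:
  assumes \<theta>: "0 \<le> \<theta>" "\<theta> \<le> T" and d: "\<bar>d1\<bar> \<le> r" "\<bar>d2\<bar> \<le> r"
  obtains e1 e2 where
    "shear d (- \<theta>) (shear d \<theta> (pi / 2, pi / 2) + (d1, d2)) = (pi / 2 + e1, pi / 2 + e2)"
    "\<bar>e1\<bar> \<le> r + T * r\<^sup>2 / 2" "\<bar>e2\<bar> \<le> r + T * r\<^sup>2 / 2"
proof -
  have bound: "\<bar>\<theta> * (1 - cos h)\<bar> \<le> T * r\<^sup>2 / 2" if "\<bar>h\<bar> \<le> r" for h
  proof -
    have "h\<^sup>2 \<le> r\<^sup>2" using that by (metis abs_ge_zero power2_abs power_mono)
    then have "\<theta> * (1 - cos h) \<le> T * (r\<^sup>2 / 2)"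
      using one_minus_cos_le[of h] \<theta> by (intro mult_mono) auto
    then show ?thesis using \<theta> by (simp add: abs_mult)
  qed
  have pos: "0 \<le> T * r\<^sup>2 / 2" using \<theta> by simp
  have s: "sin (pi / 2 + h) = cos h" "sin (h + pi / 2) = cos h" for h :: real
    by (simp_all add: sin_add)
  show ?thesis
  proof (cases d)
    case True
    show ?thesis
    proof (rule that[of "d1 + \<theta> * (1 - cos d2)" d2])
      show "\<bar>d1 + \<theta> * (1 - cos d2)\<bar> \<le> r + T * r\<^sup>2 / 2" using bound[of d2] d by linarith
      show "\<bar>d2\<bar> \<le> r + T * r\<^sup>2 / 2" using pos d by linarith
    qed (use True in \<open>simp add: shear_Pair s algebra_simps\<close>)
  next
    case False
    show ?thesis
    proof (rule that[of d1 "d2 + \<theta> * (1 - cos d1)"])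
      show "\<bar>d2 + \<theta> * (1 - cos d1)\<bar> \<le> r + T * r\<^sup>2 / 2" using bound[of d1] d by linarith
      show "\<bar>d1\<bar> \<le> r + T * r\<^sup>2 / 2" using pos d by linarith
    qed (use False in \<open>simp add: shear_Pair s algebra_simps\<close>)
  qed
qed

text \<open>The recursion \<open>r\<^sub>n = r\<^sub>n\<^sub>+\<^sub>1 + T r\<^sub>n\<^sub>+\<^sub>1\<^sup>2 / 2\<close> decays like \<open>2 / (T n)\<close>; about half of
  this value leaves room for the recursion to hold as an inequality for every \<open>n\<close>, and it makes \<open>r\<^sub>0 = 1 / T\<close> smaller than
  the distance \<open>\<pi>/2\<close> to the discontinuity.\<close>

definition plateau_radius :: "real \<Rightarrow> nat \<Rightarrow> real" where
  "plateau_radius T n = 1 / (T * real (n + 1))"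

lemma plateau_radius_Suc:
  assumes "T > 0"
  shows "plateau_radius T (Suc n) + T * (plateau_radius T (Suc n))\<^sup>2 / 2 \<le> plateau_radius T n"
proof -
  define m where "m = real n + 1"
  have m: "m > 0" by (simp add: m_def)
  have "1 / m - (1 / (m + 1) + 1 / (2 * (m + 1)\<^sup>2)) = (m + 2) / (2 * m * (m + 1)\<^sup>2)"
    using m by (simp add: divide_simps power2_eq_square) (simp add: algebra_simps)
  moreover have "(m + 2) / (2 * m * (m + 1)\<^sup>2) \<ge> 0" using m by simp
  ultimately have "1 / (m + 1) + 1 / (2 * (m + 1)\<^sup>2) \<le> 1 / m" by linarith
  then have "(1 / T) * (1 / (m + 1) + 1 / (2 * (m + 1)\<^sup>2)) \<le> (1 / T) * (1 / m)"
    using assms by (intro mult_left_mono) auto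
  moreover have R: "plateau_radius T (Suc n) = (1 / T) * (1 / (m + 1))" "plateau_radius T n = (1 / T) * (1 / m)"
    by (simp_all add: plateau_radius_def m_def algebra_simps)
  moreover have "T * (plateau_radius T (Suc n))\<^sup>2 / 2 = (1 / T) * (1 / (2 * (m + 1)\<^sup>2))"
    unfolding R using assms by (simp add: power_mult_distrib power_divide power2_eq_square)
  ultimately show ?thesis by (simp only: distrib_left)
qed

lemma profile_plateau:
  assumes T: "T > 0" "T = 2 * pi * real k"
    and d: "\<bar>d1\<bar> \<le> plateau_radius T n" "\<bar>d2\<bar> \<le> plateau_radius T n"
  shows "profile T n (pi / 2 + d1, pi / 2 + d2) = 2"
  using d
proof (induction n arbitrary: d1 d2)
  case 0
  have "T > 1" using period_multiple_ge_2[OF T] by linarith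
  then have "plateau_radius T 0 \<le> 1" by (simp add: plateau_radius_def)
  then have "\<bar>d1\<bar> < pi / 2" using 0 pi_gt3 by linarith
  then have "cos d1 > 0" by (intro cos_gt_zero_pi) auto
  then show ?case by (simp add: start_profile_def sin_add)
next
  case (Suc n)
  obtain e1 e2 where e: "shear (even n) (- T) (shear (even n) T (pi / 2, pi / 2) + (d1, d2)) = (pi / 2 + e1, pi / 2 + e2)"
    "\<bar>e1\<bar> \<le> plateau_radius T (Suc n) + T * (plateau_radius T (Suc n))\<^sup>2 / 2" "\<bar>e2\<bar> \<le> plateau_radius T (Suc n) + T * (plateau_radius T (Suc n))\<^sup>2 / 2"
    by (rule shear_near_fixed_point[OF less_imp_le[OF T(1)] order_refl Suc.prems, where d="even n"])
  \<comment> \<open>the full shear moves the base point by the lattice vector \<open>(T, 0)\<close> or \<open>(0, T)\<close>\<close>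
  let ?i = "if even n then int k else 0" and ?j = "if even n then 0 else int k"
  have "shear (even n) T (pi / 2, pi / 2) + (d1, d2) = (pi / 2 + d1, pi / 2 + d2) + (2 * pi * of_int ?i, 2 * pi * of_int ?j)"
    using T(2) by (simp add: shear_Pair)
  then have "profile T (Suc n) (pi / 2 + d1, pi / 2 + d2) = profile T (Suc n) (shear (even n) T (pi / 2, pi / 2) + (d1, d2))"
    by (simp only: periodic2_int[OF profile_periodic])
  also have "\<dots> = profile T n (pi / 2 + e1, pi / 2 + e2)" by (simp add: e(1))
  also have "\<dots> = 2"
    using e(2,3) plateau_radius_Suc[OF T(1), of n] by (intro Suc.IH) auto
  finally show ?case .
qed

lemma shear_solution_plateau:
  assumes T: "T > 0" "T = 2 * pi * real k" and \<alpha>: "\<alpha> > 0"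
    and n: "real n \<le> \<alpha>" "\<alpha> \<le> real (Suc n)"
  shows "\<exists>c\<in>torus. \<forall>y\<in>torus_ball c (plateau_radius T (Suc n)). shear_solution \<alpha> T 1 y = 2"
proof -
  define \<theta> where "\<theta> = T * (\<alpha> - real n)"
  have "\<theta> \<le> T * 1" unfolding \<theta>_def using n T by (intro mult_left_mono) auto
  then have \<theta>: "0 \<le> \<theta>" "\<theta> \<le> T" using n T by (auto simp: \<theta>_def)
  let ?q = "shear (even n) \<theta> (pi / 2, pi / 2)"
  let ?h = "\<lambda>y. profile T n (shear (even n) (- \<theta>) y)"
  have "\<alpha> * T * (1 - real n / \<alpha>) = \<theta>" using \<alpha> by (simp add: \<theta>_def field_simps)
  then have h: "shear_solution \<alpha> T 1 y = ?h y" for y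
    using shear_solution_piece[OF \<alpha>, of n 1 T y] n \<alpha> by simp
  have hper: "periodic2 ?h" by (intro periodic2_shear profile_periodic)
  obtain i j where c: "?q + (2 * pi * of_int i, 2 * pi * of_int j) \<in> torus" (is "?c \<in> _")
    by (rule reduce_to_torus)
  show ?thesis
  proof (intro bexI[OF _ c] ballI)
    fix y assume "y \<in> torus_ball ?c (plateau_radius T (Suc n))"
    then obtain m l :: int where ml: "dist ?c (y + (2*pi * of_int m, 2*pi * of_int l)) < plateau_radius T (Suc n)"
      by (auto simp: torus_ball_def)
    define d where "d = y + (2*pi * of_int m, 2*pi * of_int l) - ?c"
    have "norm d < plateau_radius T (Suc n)" using ml by (simp add: d_def dist_norm norm_minus_commute)
    then have "\<bar>fst d\<bar> \<le> plateau_radius T (Suc n)" "\<bar>snd d\<bar> \<le> plateau_radius T (Suc n)"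
      using norm_fst_le[of "fst d" "snd d"] norm_snd_le[of "snd d" "fst d"] by auto
    then obtain e1 e2 where e: "shear (even n) (- \<theta>) (?q + (fst d, snd d)) = (pi / 2 + e1, pi / 2 + e2)"
        "\<bar>e1\<bar> \<le> plateau_radius T (Suc n) + T * (plateau_radius T (Suc n))\<^sup>2 / 2" "\<bar>e2\<bar> \<le> plateau_radius T (Suc n) + T * (plateau_radius T (Suc n))\<^sup>2 / 2"
      by (rule shear_near_fixed_point[OF \<theta>, where d="even n"])
    have "?h y = ?h (y + (2*pi * of_int m, 2*pi * of_int l))"
      by (simp only: periodic2_int[OF hper])
    also have "y + (2*pi * of_int m, 2*pi * of_int l) = (?q + d) + (2 * pi * of_int i, 2 * pi * of_int j)"
      by (simp add: d_def)
    also have "?h \<dots> = ?h (?q + d)" by (rule periodic2_int[OF hper])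
    also have "\<dots> = 2"
      using e plateau_radius_Suc[OF T(1), of n] by (simp, intro profile_plateau[OF T]) auto
    finally show "shear_solution \<alpha> T 1 y = 2" by (simp add: h)
  qed
qed

section \<open>The gradient norm\<close>

lemma has_derivative_sfield:
  "((\<lambda>x. a *\<^sub>R sfield d x) has_derivative
     (\<lambda>h. a *\<^sub>R (if d then (cos (snd x) * snd h, 0) else (0, cos (fst x) * fst h)))) (at x)"
  by (cases d) (auto simp: sfield_def b_horiz_def b_vert_def intro!: derivative_eq_intros ext)

lemma onorm_frechet_sfield:
  "onorm (frechet_derivative (\<lambda>x. a *\<^sub>R sfield d x) (at x)) = \<bar>a * cos (if d then snd x else fst x)\<bar>"
proof -
  let ?L = "\<lambda>h. a *\<^sub>R (if d then (cos (snd x) * snd h, 0) else (0, cos (fst x) * fst h))"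
  have "frechet_derivative (\<lambda>x. a *\<^sub>R sfield d x) (at x) = ?L"
    by (rule frechet_derivative_at[symmetric, OF has_derivative_sfield])
  moreover have "onorm ?L = \<bar>a * cos (if d then snd x else fst x)\<bar>"
  proof (rule antisym)
    show "onorm ?L \<le> \<bar>a * cos (if d then snd x else fst x)\<bar>"
    proof (rule onorm_bound)
      fix h :: "real \<times> real"
      show "norm (?L h) \<le> \<bar>a * cos (if d then snd x else fst x)\<bar> * norm h"
        using norm_fst_le[of "fst h" "snd h"] norm_snd_le[of "snd h" "fst h"]
        by (auto simp: norm_Pair abs_mult mult.assoc intro!: mult_left_mono)
    qed simp
    have bl: "bounded_linear ?L" by (rule has_derivative_bounded_linear[OF has_derivative_sfield])
    show "\<bar>a * cos (if d then snd x else fst x)\<bar> \<le> onorm ?L"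
      using onorm[OF bl, of "if d then (0, 1) else (1, 0)"]
      by (auto simp: norm_Pair abs_mult split: if_splits)
  qed
  ultimately show ?thesis by simp
qed

lemma cos_ge_half: "0 \<le> (x::real) \<Longrightarrow> x \<le> 1 \<Longrightarrow> 1 / 2 \<le> cos x"
  using cos_monotone_0_pi_le[of x "pi / 3"] pi_gt3 by (simp add: cos_60)

text \<open>The integrand is \<open>\<alpha> T\<close> times a cosine of one of the coordinates, depending on time. On the unit
  square both cosines are at least \<open>1 / 2\<close>, so the alternation of the direction does not matter.\<close>

lemma grad_L1_norm_lower_bound:
  assumes "\<alpha> > 0" "T > 0"
  shows "\<alpha> * T / 2 \<le> grad_L1_norm (speed_up \<alpha> (shear_field (\<lambda>_. T)))"
proof -
  define K :: "real \<times> real \<times> real \<Rightarrow> real" where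
    "K p = \<bar>\<alpha> * T * cos (if odd \<lceil>\<alpha> * fst p\<rceil> then snd (snd p) else fst (snd p))\<bar>" for p
  let ?S = "cbox (0, 0, 0) (1, 1, 1) :: (real \<times> real \<times> real) set"
  have "speed_up \<alpha> (shear_field (\<lambda>_. T)) t = (\<lambda>x. (\<alpha> * T) *\<^sub>R sfield (odd \<lceil>\<alpha> * t\<rceil>) x)" for t
    by (rule ext) (rule speed_up_shear_field)
  then have grad: "grad_L1_norm (speed_up \<alpha> (shear_field (\<lambda>_. T))) = (LINT p:{0..1} \<times> torus|lborel. K p)"
    unfolding grad_L1_norm_def K_def by (simp only: onorm_frechet_sfield)
  have "(\<lambda>p. \<bar>\<alpha> * T * cos (if odd i then snd (snd p) else fst (snd p))\<bar>) \<in> borel_measurable (borel :: (real \<times> real \<times> real) measure)" for i :: int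
    by (cases "odd i") (auto intro!: borel_measurable_continuous_onI continuous_intros)
  from measurable_compose_countable[OF this measurable_index[of \<alpha>]]
  have Km: "K \<in> borel_measurable borel" by (simp add: K_def[abs_def])
  have fin: "emeasure lborel ({0..1::real} \<times> torus) < \<infinity>"
  proof -
    have "emeasure lborel ({0..1::real} \<times> torus) \<le> emeasure lborel (cbox (0, 0, 0) (1, 2 * pi, 2 * pi) :: (real \<times> real \<times> real) set)"
      by (intro emeasure_mono) (auto simp: torus_def)
    then show ?thesis by (simp add: emeasure_lborel_cbox_eq le_less_trans)
  qed
  have Ki: "set_integrable lborel ({0..1} \<times> torus) K"
    unfolding set_integrable_def
  proof (rule integrableI_bounded_set_indicator[where B="\<bar>\<alpha> * T\<bar>"])
    show "AE p in lborel. p \<in> {0..1} \<times> torus \<longrightarrow> norm (K p) \<le> \<bar>\<alpha> * T\<bar>"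
      by (rule AE_I2) (simp add: K_def abs_mult mult_left_le)
  qed (use Km fin in \<open>auto intro!: borel_Times\<close>)
  have "\<alpha> * T / 2 = (\<integral>p. indicator ?S p * (\<alpha> * T / 2) \<partial>lborel)"
    by (simp add: content_Pair)
  also have "\<dots> \<le> (\<integral>p. indicator ({0..1} \<times> torus) p * K p \<partial>lborel)"
  proof (rule integral_mono)
    show "integrable lborel (\<lambda>p. indicator ?S p * (\<alpha> * T / 2))"
      by (intro integrable_mult_left integrable_real_indicator) (auto simp: emeasure_lborel_cbox_eq)
    show "integrable lborel (\<lambda>p. indicator ({0..1} \<times> torus) p * K p)"
      using Ki by (simp add: set_integrable_def)
    fix p :: "real \<times> real \<times> real"
    show "indicator ?S p * (\<alpha> * T / 2) \<le> indicator ({0..1} \<times> torus) p * K p"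
    proof (cases "p \<in> ?S")
      case True
      let ?c = "cos (if odd \<lceil>\<alpha> * fst p\<rceil> then snd (snd p) else fst (snd p))"
      have p: "p \<in> {0..1} \<times> torus" using True pi_gt3 by (cases p) (auto simp: torus_def cbox_Pair_eq)
      have "1 / 2 \<le> ?c" 
        by (rule cos_ge_half; use True in \<open>cases p; auto simp: cbox_Pair_eq\<close>)
      then have "\<alpha> * T * (1 / 2) \<le> \<alpha> * T * ?c" using assms by (intro mult_left_mono) auto
      also have "\<dots> \<le> K p" unfolding K_def by (rule abs_ge_self)
      finally show ?thesis using True p by simp
    qed (simp add: K_def)
  qed
  finally show ?thesis by (simp add: grad set_lebesgue_integral_def)
qed

section \<open>Balls and the mixing scale\<close>

lemma torus_ball_measurable: "torus_ball c r \<in> sets borel"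
proof -
  have "torus_ball c r = torus \<inter> (\<Union>m::int. \<Union>n::int. {y. dist c (y + (2*pi * of_int m, 2*pi * of_int n)) < r})"
    by (auto simp: torus_ball_def)
  moreover have "{y. dist c (y + (2*pi * of_int m, 2*pi * of_int n)) < r} \<in> sets borel" for m n :: int
    by (intro borel_open open_Collect_less continuous_intros)
  ultimately show ?thesis by auto
qed

text \<open>The centre may lie on the lower or left edge of the fundamental square, so a box to the upper
  right of it is used.\<close>

lemma measure_torus_ball_pos:
  assumes "c \<in> torus" "r > 0"
  shows "measure lborel (torus_ball c r) > 0"
proof -
  define s where "s = min (r / 2) (min (2 * pi - fst c) (2 * pi - snd c))"
  have s: "s > 0" "s \<le> r / 2" "s \<le> 2 * pi - fst c" "s \<le> 2 * pi - snd c"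
    using assms unfolding s_def by (auto simp: torus_def min_less_iff_conj simp del: le_divide_eq_numeral1)
  have sub: "box c (fst c + s, snd c + s) \<subseteq> torus_ball c r"
  proof
    fix y assume "y \<in> box c (fst c + s, snd c + s)"
    then have y: "fst c < fst y" "fst y < fst c + s" "snd c < snd y" "snd y < snd c + s"
      using mem_box_prod[of y "fst c" "snd c" "fst c + s" "snd c + s"] by auto
    have "dist c y \<le> \<bar>fst c - fst y\<bar> + \<bar>snd c - snd y\<bar>"
      using sqrt_sum_squares_le_sum_abs[of "fst c - fst y" "snd c - snd y"] by (simp add: dist_prod_def dist_real_def)
    also have "\<dots> < r" using y s by linarith
    finally have "dist c (y + (2*pi * of_int 0, 2*pi * of_int 0)) < r" by (simp add: zero_prod_def[symmetric])
    moreover have "y \<in> torus" using y s assms by (cases y) (auto simp: torus_def)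
    ultimately show "y \<in> torus_ball c r" unfolding torus_ball_def by blast
  qed
  have fin: "emeasure lborel (torus_ball c r) < \<infinity>"
    by (rule le_less_trans[OF emeasure_mono emeasure_torus_finite]) (auto simp: torus_ball_def)
  have "0 < s * s" using s by simp
  also have "s * s = measure lborel (box c (fst c + s, snd c + s))"
    using s by (cases c) (simp add: measure_lborel_box_eq Basis_prod_def)
  also have "\<dots> \<le> measure lborel (torus_ball c r)"
    by (rule measure_mono_fmeasurable[OF sub])
       (use fin torus_ball_measurable in \<open>auto simp: fmeasurable_def\<close>)
  finally show ?thesis .
qed

lemma torus_ball_large:
  assumes "c \<in> torus" "4 * pi \<le> r"
  shows "torus_ball c r = torus"
proof
  show "torus \<subseteq> torus_ball c r"
  proof
    fix y assume y: "y \<in> torus"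
    have "dist c y \<le> \<bar>fst c - fst y\<bar> + \<bar>snd c - snd y\<bar>"
      using sqrt_sum_squares_le_sum_abs[of "fst c - fst y" "snd c - snd y"] by (simp add: dist_prod_def dist_real_def)
    also have "\<dots> < 2 * pi + 2 * pi"
      using y assms(1) by (intro add_strict_mono) (auto simp: torus_def)
    finally have "dist c (y + (2*pi * of_int 0, 2*pi * of_int 0)) < r" using assms(2) by (simp add: zero_prod_def[symmetric])
    then show "y \<in> torus_ball c r" using y unfolding torus_ball_def by blast
  qed
qed (auto simp: torus_ball_def)

lemma integral_initial_data: "(LINT x:torus|lborel. initial_data x) = 0"
proof -
  have "(LINT x:{0..<2*pi}|lborel. initial_data (x, y)) = 0" for y
  proof -
    have "(LINT x:{0..<2*pi}|lborel. initial_data (x, y)) =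
        (\<integral>x. 2 * indicator {0..pi} x - 2 * indicator {pi<..<2*pi} x \<partial>lborel)"
      unfolding set_lebesgue_integral_def
      by (rule Bochner_Integration.integral_cong) (use pi_gt3 in \<open>auto simp: initial_data_def split: split_indicator\<close>)
    also have "\<dots> = 0" by (subst Bochner_Integration.integral_diff) auto
    finally show ?thesis .
  qed
  then show ?thesis
    by (subst torus_integral_iterated(1)[where M=2])
       (auto simp: initial_data_def split: split_indicator)
qed

lemma transport_solution_mean_zero:
  assumes "transport_solution b initial_data u"
  shows "(LINT x:torus|lborel. u 1 x) = 0"
proof -
  have "(LINT x:torus|lborel. u 1 x * 1) = (LINT x:torus|lborel. initial_data x * 1) +
      (LINT p:{0..1} \<times> torus|lborel. u (fst p) (snd p) * (0 \<bullet> (1, b (fst p) (snd p))))"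
    using assms[unfolded transport_solution_def, THEN conjunct2, THEN conjunct2, rule_format, of "\<lambda>_. 1" "\<lambda>_. 0" 1]
    by (simp add: GDERIV_const space_periodic_def)
  then show ?thesis by (simp add: integral_initial_data)
qed

text \<open>The solution chosen in the definition of the mixing scale has the same ball averages at time 1 as
  the explicit one, which equals 2 on a ball. The supremum is meaningful because a ball of radius
  above \<open>4\<pi>\<close> is the whole torus, where the solution has mean zero.\<close>

lemma mix_ge_plateau_radius:
  assumes T: "T > 0" "T = 2 * pi * real k" and \<alpha>: "\<alpha> > 0"
    and n: "real n \<le> \<alpha>" "\<alpha> \<le> real (Suc n)"
  shows "plateau_radius T (Suc n) \<le> mix (speed_up \<alpha> (shear_field (\<lambda>_. T)))"
proof -
  let ?b = "speed_up \<alpha> (shear_field (\<lambda>_. T))" and ?r = "plateau_radius T (Suc n)"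
  define u where "u = the_solution ?b"
  define v where "v = shear_solution \<alpha> T"
  have v: "transport_solution ?b initial_data v"
    unfolding v_def by (rule shear_solution_is_solution[OF \<alpha>])
  then have u: "transport_solution ?b initial_data u"
    unfolding u_def the_solution_def by (rule someI[where P="transport_solution ?b initial_data"])
  obtain Mu Mv where bd: "\<And>x. \<bar>u 1 x\<bar> \<le> Mu" "\<And>x. \<bar>v 1 x\<bar> \<le> Mv"
    using u v unfolding transport_solution_def by blast
  have slice: "z 1 \<in> borel_measurable borel" if "transport_solution ?b initial_data z" for z
  proof -
    have "(\<lambda>x::real \<times> real. (1::real, x)) \<in> borel_measurable borel"
      by (intro borel_measurable_continuous_onI continuous_intros)
    from measurable_compose[OF this, of "\<lambda>p. z (fst p) (snd p)" borel] that show ?thesis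
      by (simp add: transport_solution_def)
  qed
  note [measurable] = slice[OF u] slice[OF v]
  have agree: "(LINT x:torus \<inter> A|lborel. u 1 x) = (LINT x:torus \<inter> A|lborel. v 1 x)" if A: "A \<in> sets borel" for A
  proof -
    have int: "set_integrable lborel (torus \<inter> A) (u 1)" "set_integrable lborel (torus \<inter> A) (v 1)"
      using A by (auto intro!: set_integrable_subset[OF integrable_torus] bd)
    have "(LINT x:torus \<inter> A|lborel. u 1 x - v 1 x) = 0"
    proof (rule test_functions_determine_integrals[OF _ _ _ A, where M="Mu + Mv"])
      show "\<bar>u 1 x - v 1 x\<bar> \<le> Mu + Mv" for x
        using bd[of x] by linarith
      fix \<psi> assume psi: "test_function \<psi>"
      then have c: "continuous_on UNIV \<psi>" by (rule test_function_continuous)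
      obtain N where N: "\<And>x. \<bar>\<psi> x\<bar> \<le> N"
        using psi unfolding test_function_def by (metis periodic2_continuous_bounded c)
      have [measurable]: "\<psi> \<in> borel_measurable borel" using c by (rule borel_measurable_continuous_onI)
      have "\<bar>u 1 x * \<psi> x\<bar> \<le> Mu * N" "\<bar>v 1 x * \<psi> x\<bar> \<le> Mv * N" for x
        unfolding abs_mult by (intro mult_mono bd N order_trans[OF abs_ge_zero bd(1)] order_trans[OF abs_ge_zero bd(2)] abs_ge_zero)+
      then have "set_integrable lborel torus (\<lambda>x. u 1 x * \<psi> x)" "set_integrable lborel torus (\<lambda>x. v 1 x * \<psi> x)"
        by (auto intro!: integrable_torus)
      then show "(LINT x:torus|lborel. (u 1 x - v 1 x) * \<psi> x) = 0"
        using solutions_agree_weakly[OF \<alpha> u v, of 1 \<psi>] psi by (simp add: left_diff_distrib)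
    qed measurable
    then show ?thesis using int by simp
  qed
  obtain c where c: "c \<in> torus" "\<And>y. y \<in> torus_ball c ?r \<Longrightarrow> v 1 y = 2"
    unfolding v_def using shear_solution_plateau[OF T \<alpha> n] by blast
  let ?B = "torus_ball c ?r"
  have r: "?r > 0" using T by (simp add: plateau_radius_def)
  have B: "?B \<in> sets borel" "torus \<inter> ?B = ?B"
    using torus_ball_measurable by (auto simp: torus_ball_def)
  have "(LINT x:?B|lborel. u 1 x) = (LINT x:?B|lborel. v 1 x)" using agree[OF B(1)] B(2) by simp
  also have "\<dots> = (LINT x:?B|lborel. 2)"
    by (rule set_lebesgue_integral_cong) (use B c in auto)
  also have "\<dots> = 2 * measure lborel ?B"
    by (simp add: set_lebesgue_integral_def)
  finally have avg: "1 / measure lborel ?B * (LINT x:?B|lborel. u 1 x) = 2"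
    using measure_torus_ball_pos[OF c(1) r] by simp
  have "bdd_above {r. r > 0 \<and> (\<exists>c\<in>torus. \<bar>1 / measure lborel (torus_ball c r) *
       (LINT x:torus_ball c r|lborel. u 1 x)\<bar> > 1)}"
  proof (rule bdd_aboveI[where M="4 * pi"])
    fix r assume "r \<in> {r. r > 0 \<and> (\<exists>c\<in>torus. \<bar>1 / measure lborel (torus_ball c r) *
       (LINT x:torus_ball c r|lborel. u 1 x)\<bar> > 1)}"
    then obtain c where c: "c \<in> torus" "\<bar>1 / measure lborel (torus_ball c r) * (LINT x:torus_ball c r|lborel. u 1 x)\<bar> > 1"
      by blast
    show "r \<le> 4 * pi"
    proof (rule ccontr)
      assume "\<not> r \<le> 4 * pi"
      then have "torus_ball c r = torus" by (intro torus_ball_large c) simp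
      then show False using c(2) transport_solution_mean_zero[OF u] by simp
    qed
  qed
  moreover have "\<exists>c\<in>torus. \<bar>1 / measure lborel (torus_ball c ?r) * (LINT x:torus_ball c ?r|lborel. u 1 x)\<bar> > 1"
  proof (rule bexI[OF _ c(1)])
    show "\<bar>1 / measure lborel ?B * (LINT x:?B|lborel. u 1 x)\<bar> > 1" unfolding avg by simp
  qed
  ultimately show ?thesis
    unfolding mix_def u_def[symmetric] using r by (intro cSup_upper) simp_all
qed

text \<open>For \<open>n = \<lceil>\<alpha>\<rceil> - 1\<close> the plateau radius is \<open>1 / (T (n + 2))\<close>, and \<open>n + 2 \<le> 3 \<alpha>\<close> as soon as
  \<open>\<alpha> \<ge> 1\<close>.\<close>

lemma mix_lower_bounds:
  assumes T: "T > 0" "T = 2 * pi * real k" and \<alpha>: "\<alpha> > 0"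
  shows "\<alpha> \<ge> 1 \<Longrightarrow> 1 / (3 * T) * inverse \<alpha> \<le> mix (speed_up \<alpha> (shear_field (\<lambda>_. T)))"
    and "\<alpha> < 1 \<Longrightarrow> 1 / (3 * T) \<le> mix (speed_up \<alpha> (shear_field (\<lambda>_. T)))"
proof -
  define n where "n = nat \<lceil>\<alpha>\<rceil> - 1"
  have n: "real n \<le> \<alpha>" "\<alpha> \<le> real (Suc n)" using \<alpha> unfolding n_def by linarith+
  note mix = mix_ge_plateau_radius[OF T \<alpha> n]
  have mono: "1 / (3 * T) * x \<le> plateau_radius T (Suc n)" if "x \<le> 3 / real (n + 2)" for x
  proof -
    have "1 / (3 * T) * x \<le> 1 / (3 * T) * (3 / real (n + 2))"
      using that T by (intro mult_left_mono) auto
    then show ?thesis by (simp add: plateau_radius_def)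
  qed
  show "1 / (3 * T) * inverse \<alpha> \<le> mix (speed_up \<alpha> (shear_field (\<lambda>_. T)))" if "\<alpha> \<ge> 1"
  proof (rule order_trans[OF mono mix])
    have "real (n + 2) \<le> 3 * \<alpha>" using n that by simp
    then show "inverse \<alpha> \<le> 3 / real (n + 2)" using \<alpha> by (simp add: field_simps)
  qed
  show "1 / (3 * T) \<le> mix (speed_up \<alpha> (shear_field (\<lambda>_. T)))" if "\<alpha> < 1"
  proof -
    have "n = 0" using n that by linarith
    then show ?thesis using order_trans[OF mono[of 1] mix] by simp
  qed
qed

lemma grad_L1_norm_ge:
  assumes T: "T > 0" "T = 2 * pi * real k" and \<alpha>: "\<alpha> > 0"
  shows "\<alpha> \<le> grad_L1_norm (speed_up \<alpha> (shear_field (\<lambda>_. T)))"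
proof -
  have "\<alpha> * 2 \<le> \<alpha> * T" using period_multiple_ge_2[OF T] \<alpha> by (intro mult_left_mono) auto
  then show ?thesis using grad_L1_norm_lower_bound[OF \<alpha> T(1)] by linarith
qed

text \<open>The gradient norm is at least \<open>\<alpha>\<close> and the mixing scale at least of order \<open>1 / \<alpha>\<close>, so it
  suffices that \<open>exp (\<kappa> \<alpha>)\<close> outgrows \<open>\<alpha>\<close>; its quadratic Taylor bound gives the explicit threshold
  \<open>6 T / (c \<kappa>\<^sup>2)\<close>.\<close>

lemma mixes_subexponentially_shear:
  assumes T: "T > 0" "T = 2 * pi * real k"
  shows "mixes_subexponentially (shear_field (\<lambda>_. T))"
  unfolding mixes_subexponentially_def
proof (intro allI impI landau_o.smallI)
  fix \<kappa> c :: real assume \<kappa>: "\<kappa> > 0" and c: "c > 0"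
  define A where "A = max 1 (6 * T / (c * \<kappa>\<^sup>2))"
  show "eventually (\<lambda>\<alpha>. norm (exp (- \<kappa> * grad_L1_norm (speed_up \<alpha> (shear_field (\<lambda>_. T)))))
      \<le> c * norm (mix (speed_up \<alpha> (shear_field (\<lambda>_. T))))) at_top"
    using eventually_ge_at_top[of A]
  proof eventually_elim
    fix \<alpha> assume "A \<le> \<alpha>"
    then have \<alpha>: "1 \<le> \<alpha>" "6 * T / (c * \<kappa>\<^sup>2) \<le> \<alpha>" by (auto simp: A_def)
    have "(\<kappa> * \<alpha>)\<^sup>2 / 2 \<le> exp (\<kappa> * \<alpha>)"
      using exp_lower_Taylor_quadratic[of "\<kappa> * \<alpha>"] \<kappa> \<alpha> by (smt (verit) mult_nonneg_nonneg)
    then have "inverse (exp (\<kappa> * \<alpha>)) \<le> inverse ((\<kappa> * \<alpha>)\<^sup>2 / 2)"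
      using \<kappa> \<alpha> by (intro le_imp_inverse_le) auto
    also have "\<dots> \<le> c * (1 / (3 * T) * inverse \<alpha>)"
    proof -
      have "6 * T \<le> c * \<kappa>\<^sup>2 * \<alpha>" using \<alpha>(2) c \<kappa> by (simp add: field_simps)
      then have "6 * T * \<alpha> \<le> c * \<kappa>\<^sup>2 * \<alpha> * \<alpha>" using \<alpha>(1) by (intro mult_right_mono) auto
      then show ?thesis using \<kappa> \<alpha>(1) T(1) by (simp add: field_simps power2_eq_square)
    qed
    also have "\<dots> \<le> c * mix (speed_up \<alpha> (shear_field (\<lambda>_. T)))"
      using mix_lower_bounds(1)[OF T _ \<alpha>(1)] \<alpha>(1) c by (intro mult_left_mono) auto
    also have "\<dots> \<le> c * norm (mix (speed_up \<alpha> (shear_field (\<lambda>_. T))))"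
      using c by (intro mult_left_mono) auto
    finally have "exp (- (\<kappa> * \<alpha>)) \<le> c * norm (mix (speed_up \<alpha> (shear_field (\<lambda>_. T))))"
      by (simp add: exp_minus)
    moreover have "exp (- \<kappa> * grad_L1_norm (speed_up \<alpha> (shear_field (\<lambda>_. T)))) \<le> exp (- (\<kappa> * \<alpha>))"
      using grad_L1_norm_ge[OF T, of \<alpha>] \<kappa> \<alpha>(1) by simp
    ultimately show "norm (exp (- \<kappa> * grad_L1_norm (speed_up \<alpha> (shear_field (\<lambda>_. T)))))
      \<le> c * norm (mix (speed_up \<alpha> (shear_field (\<lambda>_. T))))"
      by (simp only: real_norm_def abs_exp_cancel)
  qed
qed

theorem mainTheorem3:
  shows "(\<forall>T::real. T > 0 \<and> (\<exists>k::nat. T = 2 * pi * real k) \<longrightarrow>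
      (\<exists>c::real. c > 0 \<and>
        (\<forall>\<alpha>\<ge>1.
           mix (speed_up \<alpha> (shear_field (\<lambda>_. T))) \<ge> c * inverse \<alpha> \<and>
           c * inverse \<alpha> \<ge> c * inverse (grad_L1_norm (speed_up \<alpha> (shear_field (\<lambda>_. T))))) \<and>
        (\<forall>\<alpha>. 0 < \<alpha> \<and> \<alpha> < 1 \<longrightarrow>
           mix (speed_up \<alpha> (shear_field (\<lambda>_. T))) \<ge> c \<and>
           c * inverse \<alpha> \<ge> c * inverse (grad_L1_norm (speed_up \<alpha> (shear_field (\<lambda>_. T)))))))
    \<and> (\<forall>M::real. \<exists>T::real. T > M \<and> T > 0 \<and> mixes_subexponentially (shear_field (\<lambda>_. T)))"
proof (intro conjI allI impI)
  fix T :: real assume "T > 0 \<and> (\<exists>k::nat. T = 2 * pi * real k)"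
  then obtain k where T: "T > 0" "T = 2 * pi * real k" by blast
  have "1 / (3 * T) * inverse (grad_L1_norm (speed_up \<alpha> (shear_field (\<lambda>_. T)))) \<le> 1 / (3 * T) * inverse \<alpha>"
    if "\<alpha> > 0" for \<alpha>
    using grad_L1_norm_ge[OF T that] that T(1) by (intro mult_left_mono le_imp_inverse_le) auto
  then show "\<exists>c::real. c > 0 \<and>
        (\<forall>\<alpha>\<ge>1.
           mix (speed_up \<alpha> (shear_field (\<lambda>_. T))) \<ge> c * inverse \<alpha> \<and>
           c * inverse \<alpha> \<ge> c * inverse (grad_L1_norm (speed_up \<alpha> (shear_field (\<lambda>_. T))))) \<and>
        (\<forall>\<alpha>. 0 < \<alpha> \<and> \<alpha> < 1 \<longrightarrow>
           mix (speed_up \<alpha> (shear_field (\<lambda>_. T))) \<ge> c \<and>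
           c * inverse \<alpha> \<ge> c * inverse (grad_L1_norm (speed_up \<alpha> (shear_field (\<lambda>_. T)))))"
    using mix_lower_bounds[OF T] T(1) by (intro exI[of _ "1 / (3 * T)"]) simp
next
  fix M :: real
  have "0 < 2 * pi" by simp
  then obtain k :: nat where k: "max M 0 < real k * (2 * pi)" using reals_Archimedean3 by blast
  then have "2 * pi * real k > M" "2 * pi * real k > 0" by (auto simp: mult.commute)
  then show "\<exists>T::real. T > M \<and> T > 0 \<and> mixes_subexponentially (shear_field (\<lambda>_. T))"
    using mixes_subexponentially_shear by blast
qed

end
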